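(* Let $\mathcal{H},A,Q,\overline{s}$ be as in the context, with the trace condition $\overline{s}>0$. Consider the equation $du(t)=Au(t)\,dt+dW^Q(t)$ with $u(0)=0$. For $h>0$ let $v_n$ be the linearized implicit Euler method $v_{n+1}=J_1(v_n+\sqrt h\,\xi_n^Q)$, $v_0=0$, and let $$u_{n+1}=J_1\Big(u_n+\tfrac{\sqrt2-1}{2}\sqrt h\,J_2\xi_n^Q\Big)+\tfrac{3-\sqrt2}{2}\sqrt h\,J_2\xi_n^Q,\quad u_0=0,\qquad \overline u_n=u_n+\tfrac12\sqrt h\,J_3\xi_n^Q .$$ Let $\nu_\infty^h,\mu_\infty^h,\overline\mu_\infty^h$ be the invariant distributions of $v_n$, $u_n$, $\overline u_n$, respectively. Then for all $h>0$ and all integers $n\ge1$, $$\mathrm{reg}(\mathbb{P}_{v_n})=\mathrm{reg}(\mathbb{P}_{u_n})=\mathrm{reg}(\nu_\infty^h)=\mathrm{reg}(\mu_\infty^h)=\overline{s}+1,$$ whereas $$\mathrm{reg}(\mathbb{P}_{\overline u_n})=\mathrm{reg}(\overline\mu_\infty^h)=\overline{s}.$$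
   Context: $\mathcal{H}$ is a separable infinite-dimensional Hilbert space. $-A$ is an unbounded self-adjoint operator on $\mathcal{H}$ with eigenvalues $0<\lambda_1\le\lambda_2\le\cdots$, $\lambda_p\to+\infty$, and a complete orthonormal system of eigenvectors $(e_p)_{p\ge1}$, $Ae_p=-\lambda_pe_p$. $Q$ is a bounded non-negative self-adjoint operator on $\mathcal{H}$ with $Qe_p=q_pe_p$, where $(q_p)_{p\ge1}$ is a bounded sequence of non-negative reals. The trace condition is $$\overline{s}=\sup\{s\in(0,1):\mathrm{Trace}((-A)^{-1+s}Q)<+\infty\}>0.$$ For $s\in\mathbb{R}$ and $u\in\mathcal{H}$, $|u|_s^2=\sum_{p\ge1}\lambda_p^s|\langle u,e_p\rangle|^2\in[0,+\infty]$. For a Borel probability measure $\mu$ on $\mathcal{H}$, $\mathrm{reg}(\mu)=\sup\{s\in\mathbb{R}:\int_{\mathcal{H}}|u|_s^2\,\mu(du)<\infty\}\in\mathbb{R}\cup\{-\infty,+\infty\}$. For an $\mathcal{H}$-valued random variable $v$, $\mathbb{P}_v$ denotes its law. $W^Q(t)=\sum_{p\ge1}\sqrt{q_p}\,\beta_p(t)e_p$ with $(\beta_p)_{p\ge1}$ independent standard scalar Wiener processes. For a timestep $h>0$: $\xi_n^Q=h^{-1/2}(W^Q((n+1)h)-W^Q(nh))$, $J_1=(I-hA)^{-1}$, $J_2=(I-\frac{3-\sqrt2}{2}hA)^{-1}$, and $J_3$ satisfies $J_3QJ_3^T=(I-\frac h2A)^{-1}Q$ (e.g. $J_3=(I-\frac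 h2A)^{-1/2}$). Invariant distributions: $\nu_\infty^h$ is the unique invariant distribution of the Markov chain $v_n$; $\mu_\infty^h$ and $\overline\mu_\infty^h$ are the first and second marginals of the unique invariant distribution of the Markov chain $(u_n,\overline u_{n-1})$ on $\mathcal{H}\times\mathcal{H}$.
   Formalization: Added hypothesis: Trace((-A)^{-1+s}Q) is infinite for every s>1. Without it the supremum over (0,1) caps s̄ at 1 and the claim fails (e.g. Q=0 gives s̄=1 but every reg is +∞); exactly the cases where the claim is false are excluded. *)

theory Defs
  imports "HOL-Probability.Probability"
begin

text \<open>
  A separable real Hilbert space is a type of sort
  \<open>{real_inner, banach, second_countable_topology}\<close>. Eigenpairs are indexed from \<open>0\<close>.
\<close>

section \<open>Operators\<close>

text \<open>
  A possibly unbounded operator is a function \<open>T\<close> together with its domain \<open>D\<close>; values outside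
  \<open>D\<close> are irrelevant. The last conjunct says that the graph of the adjoint of \<open>T\<close> equals the
  graph of \<open>T\<close> (equality of domains included), i.e. that \<open>T\<close> is self-adjoint and not merely
  symmetric.
\<close>

definition self_adjoint_operator :: "'a::real_inner set \<Rightarrow> ('a \<Rightarrow> 'a) \<Rightarrow> bool" where
  "self_adjoint_operator D T \<longleftrightarrow>
     subspace D \<and> closure D = UNIV \<and>
     (\<forall>u\<in>D. \<forall>v\<in>D. T (u + v) = T u + T v) \<and>
     (\<forall>u\<in>D. \<forall>c. T (c *\<^sub>R u) = c *\<^sub>R T u) \<and>
     (\<forall>v w. (\<forall>u\<in>D. T u \<bullet> v = u \<bullet> w) \<longleftrightarrow> v \<in> D \<and> w = T v)"

definition complete_orthonormal_system :: "(nat \<Rightarrow> 'a::real_inner) \<Rightarrow> bool" where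
  "complete_orthonormal_system e \<longleftrightarrow>
     (\<forall>i j. e i \<bullet> e j = (if i = j then 1 else 0)) \<and> closure (span (range e)) = UNIV"

text \<open>\<open>(I - c A)\<^sup>-\<^sup>1\<close>, the inverse of \<open>I - c A\<close> on the domain \<open>D\<close> of \<open>A\<close>.\<close>

definition resolvent_op :: "'a::real_inner set \<Rightarrow> ('a \<Rightarrow> 'a) \<Rightarrow> real \<Rightarrow> 'a \<Rightarrow> 'a" where
  "resolvent_op D A c = the_inv_into D (\<lambda>u. u - c *\<^sub>R A u)"

text \<open>\<open>(-A)\<^sup>r\<close>, by spectral calculus in the eigenbasis of \<open>A\<close>.\<close>

definition frac_power :: "(nat \<Rightarrow> 'a::real_inner) \<Rightarrow> (nat \<Rightarrow> real) \<Rightarrow> real \<Rightarrow> 'a \<Rightarrow> 'a" where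
  "frac_power e lam r u = (\<Sum>p. (lam p powr r * (u \<bullet> e p)) *\<^sub>R e p)"

text \<open>The trace of a non-negative operator, with values in \<open>[0, \<infinity>]\<close>.\<close>

definition trace_op :: "(nat \<Rightarrow> 'a::real_inner) \<Rightarrow> ('a \<Rightarrow> 'a) \<Rightarrow> ennreal" where
  "trace_op e T = (\<Sum>p. ennreal (T (e p) \<bullet> e p))"

text \<open>The supremum is taken in \<open>[-\<infinity>, \<infinity>]\<close>, so it is \<open>-\<infinity>\<close> if no \<open>s\<close> qualifies.
  It never exceeds \<open>1\<close>, even if the trace is finite for some \<open>s > 1\<close> (e.g. for \<open>Q = 0\<close>). In that
  case it does not measure the regularity of the noise, hence the hypothesis \<open>not_truncated\<close> of the
  theorem, which says that no \<open>s > 1\<close> has finite trace.\<close>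

definition s_bar :: "(nat \<Rightarrow> 'a::real_inner) \<Rightarrow> (nat \<Rightarrow> real) \<Rightarrow> ('a \<Rightarrow> 'a) \<Rightarrow> ereal" where
  "s_bar e lam Q =
     Sup {ereal s | s. 0 < s \<and> s < 1 \<and> trace_op e (frac_power e lam (-1 + s) \<circ> Q) < \<infinity>}"

section \<open>Spatial regularity of a distribution\<close>

definition norm_sq :: "(nat \<Rightarrow> 'a::real_inner) \<Rightarrow> (nat \<Rightarrow> real) \<Rightarrow> real \<Rightarrow> 'a \<Rightarrow> ennreal" where
  "norm_sq e lam s u = (\<Sum>p. ennreal (lam p powr s * \<bar>u \<bullet> e p\<bar>\<^sup>2))"

definition reg :: "(nat \<Rightarrow> 'a::real_inner) \<Rightarrow> (nat \<Rightarrow> real) \<Rightarrow> 'a measure \<Rightarrow> ereal" where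
  "reg e lam \<mu> = Sup {ereal s | s. (\<integral>\<^sup>+ u. norm_sq e lam s u \<partial>\<mu>) < \<infinity>}"

section \<open>Noise\<close>

definition standard_wiener_process :: "'w measure \<Rightarrow> (real \<Rightarrow> 'w \<Rightarrow> real) \<Rightarrow> bool" where
  "standard_wiener_process M B \<longleftrightarrow>
     (\<forall>t\<ge>0. B t \<in> borel_measurable M) \<and>
     (AE \<omega> in M. B 0 \<omega> = 0) \<and>
     (AE \<omega> in M. continuous_on {0..} (\<lambda>t. B t \<omega>)) \<and>
     (\<forall>s t. 0 \<le> s \<and> s < t \<longrightarrow>
        distributed M lborel (\<lambda>\<omega>. B t \<omega> - B s \<omega>) (normal_density 0 (sqrt (t - s)))) \<and>
     (\<forall>t :: nat \<Rightarrow> real. 0 \<le> t 0 \<and> mono t \<longrightarrow>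
        prob_space.indep_vars M (\<lambda>_. borel) (\<lambda>i \<omega>. B (t (Suc i)) \<omega> - B (t i) \<omega>) UNIV)"

text \<open>Independence of the whole processes, as random elements of \<open>\<real>\<^bsup>[0,\<infinity>)\<^esup>\<close>.\<close>

definition independent_wiener_processes ::
    "'w measure \<Rightarrow> (nat \<Rightarrow> real \<Rightarrow> 'w \<Rightarrow> real) \<Rightarrow> bool" where
  "independent_wiener_processes M \<beta> \<longleftrightarrow>
     (\<forall>p. standard_wiener_process M (\<beta> p)) \<and>
     prob_space.indep_vars M (\<lambda>_. Pi\<^sub>M {0..} (\<lambda>_. borel))
       (\<lambda>p \<omega>. restrict (\<lambda>t. \<beta> p t \<omega>) {0..}) UNIV"

text \<open>
  Since \<open>Q\<close> need not be of trace class, the series \<open>\<Sum>p. sqrt (q p) * \<beta> p t * e p\<close> need not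
  converge in the Hilbert space: \<open>W\<^sup>Q(t)\<close> and \<open>\<xi>\<^sub>n\<^sup>Q\<close> are only cylindrical random variables. They
  are represented by their sequences of coefficients in the basis \<open>e\<close>.
\<close>

definition WQ :: "(nat \<Rightarrow> real) \<Rightarrow> (nat \<Rightarrow> real \<Rightarrow> 'w \<Rightarrow> real) \<Rightarrow> real \<Rightarrow> 'w \<Rightarrow> nat \<Rightarrow> real" where
  "WQ q \<beta> t \<omega> p = sqrt (q p) * \<beta> p t \<omega>"

definition xiQ ::
    "(nat \<Rightarrow> real) \<Rightarrow> (nat \<Rightarrow> real \<Rightarrow> 'w \<Rightarrow> real) \<Rightarrow> real \<Rightarrow> nat \<Rightarrow> 'w \<Rightarrow> nat \<Rightarrow> real" where
  "xiQ q \<beta> h n \<omega> p =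
     h powr (- 1 / 2) * (WQ q \<beta> ((real n + 1) * h) \<omega> p - WQ q \<beta> (real n * h) \<omega> p)"

text \<open>
  The value \<open>L x\<close> of a bounded operator \<open>L\<close> at the formal vector \<open>\<Sum>p. x p * e p\<close>. For a vector
  \<open>u\<close> of the space and \<open>x p = u \<bullet> e p\<close> this is \<open>L u\<close>; for the Gaussian \<open>x\<close> considered here the
  series converges almost surely as soon as the covariance \<open>L Q L\<^sup>T\<close> has finite trace.
\<close>

definition apply_op ::
    "(nat \<Rightarrow> 'a::real_inner) \<Rightarrow> ('a \<Rightarrow> 'a) \<Rightarrow> (nat \<Rightarrow> real) \<Rightarrow> 'a" where
  "apply_op e L x = (\<Sum>p. x p *\<^sub>R L (e p))"

section \<open>Numerical schemes\<close>

text \<open>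
  One step of each method, as a function of the current value and of the noise \<open>x\<close> (a coefficient
  sequence). In the Euler step \<open>J\<^sub>1\<close> acts on the formal vector \<open>v + sqrt h * x\<close>.
\<close>

definition euler_step ::
    "(nat \<Rightarrow> 'a::real_inner) \<Rightarrow> ('a \<Rightarrow> 'a) \<Rightarrow> real \<Rightarrow> 'a \<Rightarrow> (nat \<Rightarrow> real) \<Rightarrow> 'a" where
  "euler_step e J1 h v x = apply_op e J1 (\<lambda>p. v \<bullet> e p + sqrt h * x p)"

definition integrator_step ::
    "(nat \<Rightarrow> 'a::real_inner) \<Rightarrow> ('a \<Rightarrow> 'a) \<Rightarrow> ('a \<Rightarrow> 'a) \<Rightarrow> real \<Rightarrow> 'a \<Rightarrow> (nat \<Rightarrow> real) \<Rightarrow> 'a" where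
  "integrator_step e J1 J2 h u x =
     J1 (u + ((sqrt 2 - 1) / 2 * sqrt h) *\<^sub>R apply_op e J2 x)
       + ((3 - sqrt 2) / 2 * sqrt h) *\<^sub>R apply_op e J2 x"

definition postprocessor ::
    "(nat \<Rightarrow> 'a::real_inner) \<Rightarrow> ('a \<Rightarrow> 'a) \<Rightarrow> real \<Rightarrow> 'a \<Rightarrow> (nat \<Rightarrow> real) \<Rightarrow> 'a" where
  "postprocessor e J3 h u x = u + (1 / 2 * sqrt h) *\<^sub>R apply_op e J3 x"

text \<open>
  Transition kernels. The noises \<open>\<xi>\<^sub>n\<^sup>Q\<close> are independent with the same law, so the chains are
  time-homogeneous and \<open>\<xi>\<^sub>0\<^sup>Q\<close> may be used. The second chain pairs
  \<open>u\<^sub>n\<close> with the postprocessed value of \<open>u\<^sub>n\<^sub>-\<^sub>1\<close>; its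
  transition does not depend on the second component of the current state.
\<close>

definition euler_kernel ::
    "'w measure \<Rightarrow> (nat \<Rightarrow> 'a::real_inner) \<Rightarrow> ('a \<Rightarrow> 'a) \<Rightarrow> real \<Rightarrow> (nat \<Rightarrow> 'w \<Rightarrow> nat \<Rightarrow> real)
       \<Rightarrow> 'a \<Rightarrow> 'a measure" where
  "euler_kernel M e J1 h \<xi> v = distr M borel (\<lambda>\<omega>. euler_step e J1 h v (\<xi> 0 \<omega>))"

definition postprocessed_kernel ::
    "'w measure \<Rightarrow> (nat \<Rightarrow> 'a::real_inner) \<Rightarrow> ('a \<Rightarrow> 'a) \<Rightarrow> ('a \<Rightarrow> 'a) \<Rightarrow> ('a \<Rightarrow> 'a) \<Rightarrow> real
       \<Rightarrow> (nat \<Rightarrow> 'w \<Rightarrow> nat \<Rightarrow> real) \<Rightarrow> 'a \<times> 'a \<Rightarrow> ('a \<times> 'a) measure" where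
  "postprocessed_kernel M e J1 J2 J3 h \<xi> z =
     distr M borel (\<lambda>\<omega>. (integrator_step e J1 J2 h (fst z) (\<xi> 0 \<omega>),
                         postprocessor e J3 h (fst z) (\<xi> 0 \<omega>)))"

definition invariant_distribution ::
    "('s::topological_space \<Rightarrow> 's measure) \<Rightarrow> 's measure \<Rightarrow> bool" where
  "invariant_distribution K \<mu> \<longleftrightarrow>
     prob_space \<mu> \<and> sets \<mu> = sets borel \<and> \<mu> \<bind> K = \<mu>"

end

theory Submission
  imports Defs
begin

text \<open>
  In the eigenbasis of \<open>A\<close> both schemes act coefficientwise: the \<open>p\<close>-th coefficient is multiplied by
  \<open>1 / (1 + h * lam p)\<close>, and a fresh Gaussian variable of variance \<open>q p\<close> is added with a gain of the
  exact order \<open>1 / lam p\<close>. So from the first step on the coefficients have second moments of the exact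
  order \<open>q p / (lam p)\<^sup>2\<close>, and \<open>\<Sum>p. lam p powr s * q p / (lam p)\<^sup>2\<close> is the trace of
  \<open>(-A) powr (-1 + (s - 1)) Q\<close>: the critical exponent is \<open>s_bar + 1\<close>. The postprocessor adds a
  Gaussian vector with covariance \<open>h / 4 * (I - h / 2 * A)\<^sup>-\<^sup>1 Q\<close>, whose coefficients have second
  moments of the larger order \<open>q p / lam p\<close>; they dominate, and the critical exponent drops to
  \<open>s_bar\<close>.

  The dependence between state and noise never has to be analysed. The noise contribution to a new
  state is the new state minus the damped old one, and the damped old state is smoother than the noise
  contribution by two powers of \<open>lam\<close>; therefore the triangle inequality in \<open>L\<^sup>2\<close> transfers the
  order of the noise contribution to the new state (\<open>reg_eqI\<close>, \<open>step_smooth_and_reg\<close>). In the same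
  way \<open>postprocessor_reg\<close> compares the postprocessed state with its rougher summand. The same argument
  serves the iterates and the invariant distributions. For the latter an a priori bound on the second
  moments of an unknown stationary law is needed, which \<open>stationary_second_moment\<close> derives by
  truncation.

  The formal vectors of noise have to be given a meaning first. The operator \<open>J3\<close> need not be diagonal,
  so \<open>\<Sum>p. \<xi> p * J3 (e p)\<close> is a series of independent, but not orthogonal vectors. It
  converges almost surely by Kolmogorov's argument (\<open>AE_summable_noise\<close>), because
  \<open>\<Sum>p. q p * (norm (J3 (e p)))\<^sup>2\<close> is the trace of \<open>J3 Q J3\<^sup>T\<close>. The resolvents \<open>J1\<close> and \<open>J2\<close> are
  inverses on the whole space only because \<open>A\<close> is self-adjoint (\<open>resolvent_equation_solvable\<close>).
\<close>

section \<open>Orthonormal bases\<close>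

locale orthonormal_basis =
  fixes e :: "nat \<Rightarrow> 'a::{real_inner, banach}"
  assumes complete_orthonormal: "complete_orthonormal_system e"
begin

lemma inner_basis [simp]: "e i \<bullet> e j = (if i = j then 1 else 0)"
  using complete_orthonormal by (auto simp: complete_orthonormal_system_def)

lemma norm_basis [simp]: "norm (e i) = 1"
  by (simp add: norm_eq_sqrt_inner)

lemma inner_sum_basis:
  "finite I \<Longrightarrow> (\<Sum>i\<in>I. c i *\<^sub>R e i) \<bullet> e p = (if p \<in> I then c p else 0)"
  by (simp add: inner_sum_left if_distrib[of "\<lambda>x. _ * x"] cong: if_cong)

lemma norm_sum_basis:
  assumes "finite I"
  shows "(norm (\<Sum>i\<in>I. c i *\<^sub>R e i))\<^sup>2 = (\<Sum>i\<in>I. (c i)\<^sup>2)"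
  using assms
  by (simp add: power2_norm_eq_inner inner_sum_right inner_sum_basis) (simp add: power2_eq_square)

lemma basis_expansion_sums: "(\<lambda>p. (x \<bullet> e p) *\<^sub>R e p) sums x"
  unfolding sums_def LIMSEQ_iff
proof (intro allI impI)
  fix \<epsilon> :: real assume "0 < \<epsilon>"
  have "x \<in> closure (span (range e))"
    using complete_orthonormal by (simp add: complete_orthonormal_system_def)
  then obtain y where y: "y \<in> span (range e)" "dist y x < \<epsilon>"
    using \<open>0 < \<epsilon>\<close> by (auto simp: closure_approachable)
  from y(1) obtain S r where S: "finite S" "S \<subseteq> range e" "y = (\<Sum>a\<in>S. r a *\<^sub>R a)"
    by (auto simp: span_explicit)
  have inj: "inj e"
    by (rule injI) (metis inner_basis zero_neq_one)
  obtain I where I: "finite I" "S = e ` I"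
    using S(1,2) by (metis finite_subset_image)
  define c where "c = (\<lambda>i. if i \<in> I then r (e i) else 0)"
  obtain m where m: "I \<subseteq> {..<m}"
    using I(1) by (meson finite_nat_iff_bounded)
  have y_eq: "y = (\<Sum>i<n. c i *\<^sub>R e i)" if "n \<ge> m" for n
  proof -
    have "y = (\<Sum>i\<in>I. c i *\<^sub>R e i)"
      unfolding S(3) I(2) by (subst sum.reindex) (use inj in \<open>auto simp: inj_on_def c_def\<close>)
    also have "\<dots> = (\<Sum>i<n. c i *\<^sub>R e i)"
      using m that by (intro sum.mono_neutral_left) (auto simp: c_def)
    finally show ?thesis .
  qed
  show "\<exists>m. \<forall>n\<ge>m. norm ((\<Sum>p<n. (x \<bullet> e p) *\<^sub>R e p) - x) < \<epsilon>"
  proof (intro exI allI impI)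
    fix n assume "n \<ge> m"
    define s where "s = (\<Sum>p<n. (x \<bullet> e p) *\<^sub>R e p)"
    define d where "d = s - y"
    have d: "d = (\<Sum>p<n. (x \<bullet> e p - c p) *\<^sub>R e p)"
      by (simp add: d_def s_def y_eq[OF \<open>n \<ge> m\<close>] scaleR_diff_left sum_subtractf)
    \<comment> \<open>The truncation error is orthogonal to the span of the first \<open>n\<close> vectors, so the
      truncation is at least as close to \<open>x\<close> as \<open>y\<close>.\<close>
    have "(x - s) \<bullet> e p = 0" if "p < n" for p
      using that by (simp add: inner_diff_left s_def inner_sum_basis)
    then have "(x - s) \<bullet> d = 0"
      by (simp add: d inner_sum_right)
    then have "(norm (x - y))\<^sup>2 = (norm (x - s))\<^sup>2 + (norm d)\<^sup>2"
      using norm_add_Pythagorean[of "x - s" d] by (simp add: d_def orthogonal_def)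
    then have "(norm (x - s))\<^sup>2 \<le> (norm (x - y))\<^sup>2"
      by simp
    then have "norm (x - s) \<le> norm (x - y)"
      by (rule power2_le_imp_le) simp
    with y(2) show "norm (s - x) < \<epsilon>"
      by (simp add: dist_norm norm_minus_commute)
  qed
qed

lemma parseval_sums: "(\<lambda>p. (x \<bullet> e p) * (y \<bullet> e p)) sums (x \<bullet> y)"
  using bounded_linear.sums[OF bounded_linear_inner_left basis_expansion_sums, of x y]
  by (simp add: inner_commute)

lemma parseval_norm_sums: "(\<lambda>p. (x \<bullet> e p)\<^sup>2) sums (norm x)\<^sup>2"
  using parseval_sums[of x x] by (simp add: power2_eq_square dot_square_norm)

lemma eq_by_components: "(\<And>p. x \<bullet> e p = y \<bullet> e p) \<Longrightarrow> x = y"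
  using sums_unique2[OF basis_expansion_sums[of x]] basis_expansion_sums[of y] by simp

lemma riesz_fischer:
  assumes "summable (\<lambda>p. (c p)\<^sup>2)"
  shows "summable (\<lambda>p. c p *\<^sub>R e p)"
  unfolding summable_Cauchy
proof (intro allI impI)
  fix \<epsilon> :: real assume "0 < \<epsilon>"
  then obtain N where N: "\<And>m n. m \<ge> N \<Longrightarrow> norm (\<Sum>p\<in>{m..<n}. (c p)\<^sup>2) < \<epsilon>\<^sup>2"
    using assms unfolding summable_Cauchy by (meson zero_less_power)
  show "\<exists>N. \<forall>m\<ge>N. \<forall>n. norm (\<Sum>p\<in>{m..<n}. c p *\<^sub>R e p) < \<epsilon>"
  proof (intro exI allI impI)
    fix m n assume "m \<ge> N"
    have "(norm (\<Sum>p\<in>{m..<n}. c p *\<^sub>R e p))\<^sup>2 < \<epsilon>\<^sup>2"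
      using N[OF \<open>m \<ge> N\<close>, of n] by (simp add: norm_sum_basis sum_nonneg)
    then show "norm (\<Sum>p\<in>{m..<n}. c p *\<^sub>R e p) < \<epsilon>"
      by (rule power2_less_imp_less) (use \<open>0 < \<epsilon>\<close> in simp)
  qed
qed

lemma inner_suminf_basis:
  assumes "summable (\<lambda>p. c p *\<^sub>R e p)"
  shows "(\<Sum>p. c p *\<^sub>R e p) \<bullet> e i = c i"
proof -
  have "(\<lambda>p. (c p *\<^sub>R e p) \<bullet> e i) sums ((\<Sum>p. c p *\<^sub>R e p) \<bullet> e i)"
    by (rule bounded_linear.sums[OF bounded_linear_inner_left summable_sums[OF assms]])
  moreover have "(\<lambda>p. (c p *\<^sub>R e p) \<bullet> e i) = (\<lambda>p. if p = i then c p else 0)"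
    by auto
  ultimately show ?thesis
    using sums_single[of i c] sums_unique2 by metis
qed

text \<open>
  Partial sums of the candidate for the adjoint at \<open>y\<close> have a norm of at most \<open>\<parallel>f\<parallel> \<parallel>y\<parallel>\<close>: their
  squared norm is \<open>y \<bullet> f w\<close>, where \<open>w\<close> is the partial sum itself.
\<close>

lemma adjoint_works_hilbert:
  fixes f :: "'a \<Rightarrow> 'a"
  assumes "bounded_linear f"
  shows "f x \<bullet> y = x \<bullet> adjoint f y"
proof -
  interpret f: bounded_linear f by fact
  obtain K where K: "K > 0" "\<And>x. norm (f x) \<le> norm x * K"
    using f.pos_bounded by blast
  have ex: "\<exists>z. \<forall>x. f x \<bullet> y = x \<bullet> z" for y
  proof -
    define c where "c = (\<lambda>p. f (e p) \<bullet> y)"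
    have bound: "(\<Sum>p<n. (c p)\<^sup>2) \<le> (K * norm y)\<^sup>2" for n
    proof -
      define w where "w = (\<Sum>p<n. c p *\<^sub>R e p)"
      have w: "(norm w)\<^sup>2 = (\<Sum>p<n. (c p)\<^sup>2)"
        unfolding w_def by (rule norm_sum_basis) simp
      have "(\<Sum>p<n. (c p)\<^sup>2) = f w \<bullet> y"
        by (simp add: w_def f.sum f.scaleR inner_sum_left c_def power2_eq_square)
      also have "\<dots> \<le> norm (f w) * norm y"
        by (rule norm_cauchy_schwarz)
      also have "\<dots> \<le> norm w * K * norm y"
        by (intro mult_right_mono K) simp
      finally have "(norm w)\<^sup>2 \<le> norm w * K * norm y"
        by (simp add: w)
      then have "norm w * norm w \<le> norm w * (K * norm y)"
        by (simp add: power2_eq_square mult.assoc)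
      then have "norm w \<le> K * norm y"
        using K(1) by (cases "norm w = 0") (auto simp: mult_le_cancel_left)
      then show ?thesis
        using w by (metis norm_ge_zero power_mono)
    qed
    have "summable (\<lambda>p. (c p)\<^sup>2)"
      by (rule summableI_nonneg_bounded[OF _ bound]) simp
    then have s: "summable (\<lambda>p. c p *\<^sub>R e p)"
      by (rule riesz_fischer)
    have "f x \<bullet> y = x \<bullet> (\<Sum>p. c p *\<^sub>R e p)" for x
    proof -
      have "(\<lambda>p. f ((x \<bullet> e p) *\<^sub>R e p) \<bullet> y) sums (f x \<bullet> y)"
        by (intro bounded_linear.sums[OF bounded_linear_inner_left] f.sums basis_expansion_sums)
      then have "(\<lambda>p. (x \<bullet> e p) * c p) sums (f x \<bullet> y)"
        by (simp add: f.scaleR c_def)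
      moreover have "(\<lambda>p. (x \<bullet> e p) * c p) sums (x \<bullet> (\<Sum>p. c p *\<^sub>R e p))"
        using parseval_sums[of x "\<Sum>p. c p *\<^sub>R e p"] by (simp add: inner_suminf_basis[OF s])
      ultimately show ?thesis
        by (rule sums_unique2)
    qed
    then show ?thesis by blast
  qed
  then obtain f' where "\<forall>x y. f x \<bullet> y = x \<bullet> f' y"
    by metis
  then have "\<forall>x y. f x \<bullet> y = x \<bullet> adjoint f y"
    unfolding adjoint_def by (rule someI[where P="\<lambda>f'. \<forall>x y. f x \<bullet> y = x \<bullet> f' y"])
  then show ?thesis by simp
qed

end

section \<open>Resolvents of the generator\<close>

locale diagonal_operator = orthonormal_basis e
  for e :: "nat \<Rightarrow> 'a::{real_inner, banach, second_countable_topology}" +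
  fixes D :: "'a set" and A :: "'a \<Rightarrow> 'a" and lam :: "nat \<Rightarrow> real"
  assumes self_adjoint: "self_adjoint_operator D (\<lambda>x. - A x)"
    and eigen_pair: "\<And>p. e p \<in> D \<and> A (e p) = - (lam p *\<^sub>R e p)"
    and eigenvalue_0_pos: "0 < lam 0"
    and eigenvalues_mono: "incseq lam"
    and eigenvalues_at_top: "filterlim lam at_top sequentially"
begin

lemma eigenvalue_ge_first: "lam 0 \<le> lam p"
  using eigenvalues_mono by (simp add: incseq_def)

lemma eigenvalue_pos [simp]: "0 < lam p"
  using eigenvalue_ge_first[of p] eigenvalue_0_pos by linarith

lemma A_component:
  assumes "x \<in> D"
  shows "A x \<bullet> e p = - (lam p * (x \<bullet> e p))"
proof -
  have "\<forall>v w. (\<forall>u\<in>D. - A u \<bullet> v = u \<bullet> w) \<longleftrightarrow> v \<in> D \<and> w = - A v"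
    using self_adjoint unfolding self_adjoint_operator_def by blast
  then have "- A x \<bullet> e p = x \<bullet> (- A (e p))"
    using assms eigen_pair by metis
  then show ?thesis
    by (simp add: eigen_pair)
qed

text \<open>
  Self-adjointness enters through the maximality of the domain: a vector \<open>x\<close> for which
  \<open>\<Sum>p. lam p * (x \<bullet> e p) * e p\<close> converges lies in \<open>D\<close>. Without it, \<open>I - c A\<close> could fail to be onto
  and its inverse would be meaningless outside the range.
\<close>

lemma resolvent_equation_solvable:
  assumes "0 < c"
  shows "\<exists>x\<in>D. x - c *\<^sub>R A x = y"
proof -
  define a where "a = (\<lambda>p. (y \<bullet> e p) / (1 + c * lam p))"
  have "summable (\<lambda>p. (a p)\<^sup>2)"
  proof (rule summable_comparison_test_ev[OF always_eventually])
    show "summable (\<lambda>p. (y \<bullet> e p)\<^sup>2)"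
      using parseval_norm_sums by (rule sums_summable)
    show "\<forall>p. norm ((a p)\<^sup>2) \<le> (y \<bullet> e p)\<^sup>2"
    proof
      fix p
      have "1 \<le> 1 + c * lam p"
        using assms by (simp add: less_imp_le)
      then have "\<bar>a p\<bar> \<le> \<bar>y \<bullet> e p\<bar>"
        by (simp add: a_def abs_divide divide_le_eq mult_left_le_one_le[of "\<bar>_\<bar>"]
            mult_le_cancel_left1)
      then show "norm ((a p)\<^sup>2) \<le> (y \<bullet> e p)\<^sup>2"
        by (simp add: abs_le_square_iff)
    qed
  qed
  then have s: "summable (\<lambda>p. a p *\<^sub>R e p)"
    by (rule riesz_fischer)
  define x where "x = (\<Sum>p. a p *\<^sub>R e p)"
  have x: "x \<bullet> e p = a p" for p
    unfolding x_def by (rule inner_suminf_basis[OF s])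
  define w where "w = (1 / c) *\<^sub>R (y - x)"
  have w: "w \<bullet> e p = lam p * a p" for p
  proof -
    have "1 + c * lam p \<noteq> 0"
      using assms eigenvalue_pos[of p] by (metis add_pos_pos less_irrefl mult_pos_pos zero_less_one)
    then have "y \<bullet> e p = a p * (1 + c * lam p)"
      by (simp add: a_def)
    then show ?thesis
      using assms by (simp add: w_def inner_diff_left x field_simps)
  qed
  have "\<forall>u\<in>D. - A u \<bullet> x = u \<bullet> w"
  proof
    fix u assume u: "u \<in> D"
    have "(\<lambda>p. (- A u \<bullet> e p) * (x \<bullet> e p)) sums (- A u \<bullet> x)"
      by (rule parseval_sums)
    moreover have "(\<lambda>p. (u \<bullet> e p) * (w \<bullet> e p)) sums (u \<bullet> w)"
      by (rule parseval_sums)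
    moreover have "(- A u \<bullet> e p) * (x \<bullet> e p) = (u \<bullet> e p) * (w \<bullet> e p)" for p
      using A_component[OF u, of p] by (simp add: x w)
    ultimately show "- A u \<bullet> x = u \<bullet> w"
      using sums_unique2 by simp
  qed
  then have "x \<in> D \<and> w = - A x"
    using self_adjoint unfolding self_adjoint_operator_def by blast
  then have "x \<in> D" and w_eq: "w = - A x"
    by auto
  have "y - x = c *\<^sub>R w"
    using assms by (simp add: w_def)
  then have "x - c *\<^sub>R A x = y"
    unfolding w_eq by (simp add: algebra_simps)
  with \<open>x \<in> D\<close> show ?thesis by blast
qed

lemma resolvent_component:
  assumes c: "0 < c"
  shows "resolvent_op D A c y \<bullet> e p = (y \<bullet> e p) / (1 + c * lam p)"
proof -
  have comp: "(x - c *\<^sub>R A x) \<bullet> e p = (1 + c * lam p) * (x \<bullet> e p)" if "x \<in> D" for x p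
    by (simp add: inner_diff_left A_component[OF that] algebra_simps)
  have nz: "1 + c * lam p \<noteq> 0" for p
    using c eigenvalue_pos[of p] by (metis add_pos_pos less_irrefl mult_pos_pos zero_less_one)
  have "inj_on (\<lambda>x. x - c *\<^sub>R A x) D"
  proof (rule inj_onI)
    fix x x' assume "x \<in> D" "x' \<in> D" "x - c *\<^sub>R A x = x' - c *\<^sub>R A x'"
    then have "x \<bullet> e p = x' \<bullet> e p" for p
      using comp[of x p] comp[of x' p] nz[of p] by simp
    then show "x = x'" by (rule eq_by_components)
  qed
  moreover obtain x where x: "x \<in> D" "x - c *\<^sub>R A x = y"
    using resolvent_equation_solvable[OF c] by blast
  ultimately have "resolvent_op D A c y = x"
    unfolding resolvent_op_def by (metis (mono_tags, lifting) the_inv_into_f_f)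
  then show ?thesis
    using comp[OF x(1), of p] x(2) nz[of p] by simp
qed

lemma resolvent_basis:
  assumes "0 < c"
  shows "resolvent_op D A c (e p) = (1 / (1 + c * lam p)) *\<^sub>R e p"
  by (rule eq_by_components) (simp add: resolvent_component[OF assms])

lemma resolvent_expansion:
  assumes "0 < c"
  shows "(\<lambda>p. ((y \<bullet> e p) / (1 + c * lam p)) *\<^sub>R e p) sums resolvent_op D A c y"
  using basis_expansion_sums[of "resolvent_op D A c y"]
  by (simp add: resolvent_component[OF assms])

lemma resolvent_measurable:
  assumes "0 < c"
  shows "resolvent_op D A c \<in> borel_measurable borel"
proof -
  have "resolvent_op D A c = (\<lambda>y. \<Sum>p. ((y \<bullet> e p) / (1 + c * lam p)) *\<^sub>R e p)"
    using sums_unique[OF resolvent_expansion[OF assms]] by auto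
  also have "\<dots> \<in> borel_measurable borel"
    by measurable
  finally show ?thesis .
qed

end

section \<open>Random series with values in a Hilbert space\<close>

text \<open>
  The partial sums of \<open>\<Sum>p. x p * a p\<close>, frozen at the first one of norm at least \<open>\<epsilon>\<close>. An excursion of
  the partial sums is thus still visible in the last stopped sum, and whether the next term is added
  depends on the earlier terms only.
\<close>

primrec stopped_sum ::
    "real \<Rightarrow> (nat \<Rightarrow> 'a::real_normed_vector) \<Rightarrow> (nat \<Rightarrow> real) \<Rightarrow> nat \<Rightarrow> 'a" where
  "stopped_sum \<epsilon> a x 0 = 0"
| "stopped_sum \<epsilon> a x (Suc n) =
     stopped_sum \<epsilon> a x n + (if norm (stopped_sum \<epsilon> a x n) < \<epsilon> then x n *\<^sub>R a n else 0)"

lemma stopped_sum_cong: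
  "(\<And>i. i < n \<Longrightarrow> x i = y i) \<Longrightarrow> stopped_sum \<epsilon> a x n = stopped_sum \<epsilon> a y n"
  by (induction n) auto

lemma stopped_sum_small:
  assumes "0 < \<epsilon>" "norm (stopped_sum \<epsilon> a x n) < \<epsilon>"
  shows "stopped_sum \<epsilon> a x n = (\<Sum>p<n. x p *\<^sub>R a p) \<and> (\<forall>k\<le>n. norm (\<Sum>p<k. x p *\<^sub>R a p) < \<epsilon>)"
  using assms(2)
proof (induction n)
  case 0
  then show ?case using assms(1) by simp
next
  case (Suc n)
  then have small: "norm (stopped_sum \<epsilon> a x n) < \<epsilon>"
    by (auto split: if_splits)
  with Suc.IH have IH: "stopped_sum \<epsilon> a x n = (\<Sum>p<n. x p *\<^sub>R a p)"
    "\<forall>k\<le>n. norm (\<Sum>p<k. x p *\<^sub>R a p) < \<epsilon>"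
    by auto
  have eq: "stopped_sum \<epsilon> a x (Suc n) = (\<Sum>p<Suc n. x p *\<^sub>R a p)"
    using small IH(1) by simp
  moreover have "norm (\<Sum>p<k. x p *\<^sub>R a p) < \<epsilon>" if "k \<le> Suc n" for k
    using that IH(2) eq Suc.prems by (metis le_Suc_eq)
  ultimately show ?case by blast
qed

lemma stopped_sum_measurable_Pi:
  fixes a :: "nat \<Rightarrow> 'a::{real_normed_vector, second_countable_topology}"
  assumes "n \<le> m"
  shows "(\<lambda>x. stopped_sum \<epsilon> a x n) \<in> borel_measurable (Pi\<^sub>M {..<m} (\<lambda>_. borel))"
  using assms
proof (induction n)
  case 0
  then show ?case by simp
next
  case (Suc n)
  then have [measurable]: "(\<lambda>x. stopped_sum \<epsilon> a x n) \<in> borel_measurable (Pi\<^sub>M {..<m} (\<lambda>_. borel))"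
    "(\<lambda>x. x n) \<in> borel_measurable (Pi\<^sub>M {..<m} (\<lambda>_. borel :: real measure))"
    by (auto intro: measurable_component_singleton)
  show ?case
    unfolding stopped_sum.simps by measurable
qed

locale white_noise = prob_space M
  for M :: "'w measure" +
  fixes X :: "nat \<Rightarrow> 'w \<Rightarrow> real"
  assumes indep: "indep_vars (\<lambda>_. borel) X UNIV"
    and integrable_noise: "\<And>p. integrable M (X p)"
    and integrable_noise_square: "\<And>p. integrable M (\<lambda>\<omega>. (X p \<omega>)\<^sup>2)"
    and expectation_noise: "\<And>p. expectation (X p) = 0"
    and expectation_noise_square: "\<And>p. expectation (\<lambda>\<omega>. (X p \<omega>)\<^sup>2) = 1"
begin

lemma noise_measurable [measurable]: "X p \<in> borel_measurable M"
  using integrable_noise by (rule borel_measurable_integrable)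

lemma second_moment_finite_sum:
  assumes "finite I"
  shows "integrable M (\<lambda>\<omega>. (\<Sum>p\<in>I. X p \<omega> * c p)\<^sup>2)"
    and "expectation (\<lambda>\<omega>. (\<Sum>p\<in>I. X p \<omega> * c p)\<^sup>2) = (\<Sum>p\<in>I. (c p)\<^sup>2)"
proof -
  have pair: "integrable M (\<lambda>\<omega>. X i \<omega> * X j \<omega>)"
    "expectation (\<lambda>\<omega>. X i \<omega> * X j \<omega>) = (if i = j then 1 else 0)" for i j
  proof -
    have "integrable M (\<lambda>\<omega>. X i \<omega> * X j \<omega>) \<and>
        expectation (\<lambda>\<omega>. X i \<omega> * X j \<omega>) = (if i = j then 1 else 0)"
    proof (cases "i = j")
      case True
      then show ?thesis
        using integrable_noise_square[of i] expectation_noise_square[of i]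
        by (simp add: power2_eq_square)
    next
      case False
      then have "indep_var borel ((\<lambda>x. x i) \<circ> (\<lambda>\<omega>. restrict (\<lambda>p. X p \<omega>) {i}))
          borel ((\<lambda>x. x j) \<circ> (\<lambda>\<omega>. restrict (\<lambda>p. X p \<omega>) {j}))"
        by (intro indep_var_compose[OF indep_var_restrict[OF indep]]) auto
      moreover have "(\<lambda>x. x p) \<circ> (\<lambda>\<omega>. restrict (\<lambda>p. X p \<omega>) {p}) = X p" for p
        by auto
      ultimately have "indep_var borel (X i) borel (X j)"
        by simp
      then show ?thesis
        using False integrable_noise indep_var_lebesgue_integral[of "X i" "X j"]
          indep_var_integrable[of "X i" "X j"] expectation_noise by simp
    qed
    then show "integrable M (\<lambda>\<omega>. X i \<omega> * X j \<omega>)"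
      "expectation (\<lambda>\<omega>. X i \<omega> * X j \<omega>) = (if i = j then 1 else 0)" by auto
  qed
  have eq: "(\<Sum>p\<in>I. X p \<omega> * c p)\<^sup>2 = (\<Sum>i\<in>I. \<Sum>j\<in>I. (c i * c j) * (X i \<omega> * X j \<omega>))" for \<omega>
    by (simp add: power2_eq_square sum_product mult_ac)
  show "integrable M (\<lambda>\<omega>. (\<Sum>p\<in>I. X p \<omega> * c p)\<^sup>2)"
    unfolding eq using pair by (intro Bochner_Integration.integrable_sum) simp
  have "expectation (\<lambda>\<omega>. (\<Sum>p\<in>I. X p \<omega> * c p)\<^sup>2) =
      (\<Sum>i\<in>I. \<Sum>j\<in>I. (c i * c j) * (if i = j then 1 else 0))"
    unfolding eq using pair by (simp add: Bochner_Integration.integral_sum)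
  also have "\<dots> = (\<Sum>i\<in>I. (c i)\<^sup>2)"
    using assms by (simp add: if_distrib[of "\<lambda>x. _ * x"] power2_eq_square cong: if_cong)
  finally show "expectation (\<lambda>\<omega>. (\<Sum>p\<in>I. X p \<omega> * c p)\<^sup>2) = (\<Sum>p\<in>I. (c p)\<^sup>2)" .
qed

text \<open>
  The increment of the stopped sum is a bounded function of the past times the next noise
  variable, so it is uncorrelated with the past.
\<close>

lemma stopped_sum_second_moment:
  fixes a :: "nat \<Rightarrow> 'a::{real_inner, second_countable_topology}"
  assumes "0 < \<epsilon>"
  shows "integrable M (\<lambda>\<omega>. (norm (stopped_sum \<epsilon> a (\<lambda>p. X p \<omega>) n))\<^sup>2) \<and>
    expectation (\<lambda>\<omega>. (norm (stopped_sum \<epsilon> a (\<lambda>p. X p \<omega>) n))\<^sup>2) \<le> (\<Sum>p<n. (norm (a p))\<^sup>2)"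
proof (induction n)
  case 0
  then show ?case by simp
next
  case (Suc n)
  define T where "T = (\<lambda>\<omega>. stopped_sum \<epsilon> a (\<lambda>p. X p \<omega>) n)"
  define g where "g = (\<lambda>x. if norm (stopped_sum \<epsilon> a x n) < \<epsilon>
    then 2 * (stopped_sum \<epsilon> a x n \<bullet> a n) else 0)"
  define G where "G = (\<lambda>\<omega>. g (\<lambda>p. X p \<omega>))"
  define H where "H = (\<lambda>\<omega>. if norm (T \<omega>) < \<epsilon> then (norm (a n))\<^sup>2 else 0)"
  have T_restrict: "stopped_sum \<epsilon> a (restrict (\<lambda>p. X p \<omega>) {..<n}) n = T \<omega>" for \<omega>
    unfolding T_def by (rule stopped_sum_cong) simp
  have stopped_meas[measurable]:
    "(\<lambda>x. stopped_sum \<epsilon> a x n) \<in> borel_measurable (Pi\<^sub>M {..<n} (\<lambda>_. borel))"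
    by (rule stopped_sum_measurable_Pi) simp
  have g_meas: "g \<in> borel_measurable (Pi\<^sub>M {..<n} (\<lambda>_. borel))"
    unfolding g_def by measurable
  have restrict_meas: "(\<lambda>\<omega>. restrict (\<lambda>p. X p \<omega>) {..<n}) \<in> measurable M (Pi\<^sub>M {..<n} (\<lambda>_. borel))"
    by measurable
  have T_meas[measurable]: "T \<in> borel_measurable M"
    using measurable_compose[OF restrict_meas stopped_meas] by (simp add: T_restrict)
  have G_eq: "G = g \<circ> (\<lambda>\<omega>. restrict (\<lambda>p. X p \<omega>) {..<n})"
    by (auto simp: G_def g_def T_restrict fun_eq_iff) (auto simp: T_def)
  have [measurable]: "G \<in> borel_measurable M"
    using measurable_compose[OF restrict_meas g_meas] by (simp add: G_eq comp_def)
  have [measurable]: "H \<in> borel_measurable M"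
    unfolding H_def by measurable
  have "indep_var borel (g \<circ> (\<lambda>\<omega>. restrict (\<lambda>p. X p \<omega>) {..<n}))
      borel ((\<lambda>x. x n) \<circ> (\<lambda>\<omega>. restrict (\<lambda>p. X p \<omega>) {n}))"
    by (intro indep_var_compose[OF indep_var_restrict[OF indep]] g_meas) auto
  moreover have "(\<lambda>x. x n) \<circ> (\<lambda>\<omega>. restrict (\<lambda>p. X p \<omega>) {n}) = X n"
    by auto
  ultimately have indep_G: "indep_var borel G borel (X n)"
    by (simp add: G_eq)
  have "\<bar>G \<omega>\<bar> \<le> 2 * (\<epsilon> * norm (a n))" for \<omega>
  proof (cases "norm (T \<omega>) < \<epsilon>")
    case True
    have "\<bar>T \<omega> \<bullet> a n\<bar> \<le> norm (T \<omega>) * norm (a n)"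
      by (rule Cauchy_Schwarz_ineq2)
    also have "\<dots> \<le> \<epsilon> * norm (a n)"
      using True by (intro mult_right_mono) auto
    finally show ?thesis
      using True by (simp add: G_def g_def T_def abs_mult)
  next
    case False
    then show ?thesis
      using assms by (simp add: G_def g_def T_def)
  qed
  then have int_G: "integrable M G"
    by (intro integrable_const_bound[where B="2 * (\<epsilon> * norm (a n))"]) auto
  have int_GX: "integrable M (\<lambda>\<omega>. G \<omega> * X n \<omega>)"
    and exp_GX: "expectation (\<lambda>\<omega>. G \<omega> * X n \<omega>) = 0"
    using indep_var_integrable[OF indep_G int_G integrable_noise]
      indep_var_lebesgue_integral[OF indep_G int_G integrable_noise] expectation_noise by auto
  have HX_le: "H \<omega> * (X n \<omega>)\<^sup>2 \<le> (norm (a n))\<^sup>2 * (X n \<omega>)\<^sup>2" "0 \<le> H \<omega> * (X n \<omega>)\<^sup>2" for \<omega>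
    by (auto simp: H_def)
  have int_aX: "integrable M (\<lambda>\<omega>. (norm (a n))\<^sup>2 * (X n \<omega>)\<^sup>2)"
    using integrable_noise_square by simp
  have int_HX: "integrable M (\<lambda>\<omega>. H \<omega> * (X n \<omega>)\<^sup>2)"
    by (rule Bochner_Integration.integrable_bound[OF int_aX]) (use HX_le in auto)
  have "expectation (\<lambda>\<omega>. H \<omega> * (X n \<omega>)\<^sup>2) \<le> expectation (\<lambda>\<omega>. (norm (a n))\<^sup>2 * (X n \<omega>)\<^sup>2)"
    by (rule integral_mono[OF int_HX int_aX]) (rule HX_le)
  then have exp_HX: "expectation (\<lambda>\<omega>. H \<omega> * (X n \<omega>)\<^sup>2) \<le> (norm (a n))\<^sup>2"
    using expectation_noise_square by simp
  have decomp: "(norm (stopped_sum \<epsilon> a (\<lambda>p. X p \<omega>) (Suc n)))\<^sup>2 =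
      (norm (T \<omega>))\<^sup>2 + (G \<omega> * X n \<omega> + H \<omega> * (X n \<omega>)\<^sup>2)" for \<omega>
    by (simp add: T_def G_def g_def H_def power2_norm_eq_inner inner_add inner_commute)
       (simp add: power2_eq_square algebra_simps)
  have IH: "integrable M (\<lambda>\<omega>. (norm (T \<omega>))\<^sup>2)"
    "expectation (\<lambda>\<omega>. (norm (T \<omega>))\<^sup>2) \<le> (\<Sum>p<n. (norm (a p))\<^sup>2)"
    using Suc by (auto simp: T_def)
  show ?case
    unfolding decomp using IH int_GX int_HX exp_GX exp_HX by simp
qed

text \<open>Kolmogorov's maximal inequality, as Chebyshev's inequality for the stopped sum.\<close>

lemma maximal_inequality:
  fixes a :: "nat \<Rightarrow> 'a::{real_inner, second_countable_topology}"
  assumes "0 < \<epsilon>"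
  shows "prob {\<omega>\<in>space M. \<exists>k\<le>n. \<epsilon> \<le> norm (\<Sum>p<k. X p \<omega> *\<^sub>R a p)}
    \<le> (\<Sum>p<n. (norm (a p))\<^sup>2) / \<epsilon>\<^sup>2"
proof -
  let ?T = "\<lambda>\<omega>. stopped_sum \<epsilon> a (\<lambda>p. X p \<omega>) n"
  have int: "integrable M (\<lambda>\<omega>. (norm (?T \<omega>))\<^sup>2)"
    and le: "expectation (\<lambda>\<omega>. (norm (?T \<omega>))\<^sup>2) \<le> (\<Sum>p<n. (norm (a p))\<^sup>2)"
    using stopped_sum_second_moment[OF assms, of a n] by auto
  have meas: "(\<lambda>\<omega>. (norm (?T \<omega>))\<^sup>2) \<in> borel_measurable M"
    using int by (rule borel_measurable_integrable)
  have "prob {\<omega>\<in>space M. \<exists>k\<le>n. \<epsilon> \<le> norm (\<Sum>p<k. X p \<omega> *\<^sub>R a p)}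
      \<le> prob {\<omega>\<in>space M. \<epsilon>\<^sup>2 \<le> (norm (?T \<omega>))\<^sup>2}"
  proof (rule finite_measure_mono)
    show "{\<omega>\<in>space M. \<epsilon>\<^sup>2 \<le> (norm (?T \<omega>))\<^sup>2} \<in> events"
      using meas by measurable
    show "{\<omega>\<in>space M. \<exists>k\<le>n. \<epsilon> \<le> norm (\<Sum>p<k. X p \<omega> *\<^sub>R a p)}
        \<subseteq> {\<omega>\<in>space M. \<epsilon>\<^sup>2 \<le> (norm (?T \<omega>))\<^sup>2}"
    proof safe
      fix \<omega> k assume "k \<le> n" "\<epsilon> \<le> norm (\<Sum>p<k. X p \<omega> *\<^sub>R a p)"
      then have "\<epsilon> \<le> norm (?T \<omega>)"
        using stopped_sum_small[OF assms, of a "\<lambda>p. X p \<omega>" n] by force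
      then show "\<epsilon>\<^sup>2 \<le> (norm (?T \<omega>))\<^sup>2"
        using assms by (intro power_mono) auto
    qed
  qed
  also have "\<dots> \<le> expectation (\<lambda>\<omega>. (norm (?T \<omega>))\<^sup>2) / \<epsilon>\<^sup>2"
    by (rule integral_Markov_inequality_measure[OF int, where A="{}", simplified])
       (use assms in auto)
  also have "\<dots> \<le> (\<Sum>p<n. (norm (a p))\<^sup>2) / \<epsilon>\<^sup>2"
    using le assms by (intro divide_right_mono) auto
  finally show ?thesis .
qed

text \<open>
  Applied to the tails of the series, the maximal inequality shows that the oscillation of the
  partial sums after the \<open>m\<close>-th one tends to \<open>0\<close> in probability as \<open>m\<close> grows; since it is monotone
  in \<open>m\<close> up to a factor \<open>2\<close>, the partial sums are almost surely Cauchy.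
\<close>

lemma AE_summable_noise:
  fixes a :: "nat \<Rightarrow> 'a::{real_inner, banach, second_countable_topology}"
  assumes "summable (\<lambda>p. (norm (a p))\<^sup>2)"
  shows "AE \<omega> in M. summable (\<lambda>p. X p \<omega> *\<^sub>R a p)"
proof -
  define S where "S = (\<lambda>m k \<omega>. \<Sum>p\<in>{m..<k}. X p \<omega> *\<^sub>R a p)"
  have [measurable]: "S m k \<in> borel_measurable M" for m k
    unfolding S_def by measurable
  define r where "r = (\<lambda>m. \<Sum>p. (norm (a (p + m)))\<^sup>2)"
  have r: "r \<longlonglongrightarrow> 0"
    unfolding r_def using suminf_exist_split2[OF assms] .
  have tail: "prob {\<omega>\<in>space M. \<exists>k\<ge>m. \<epsilon> \<le> norm (S m k \<omega>)} \<le> r m / \<epsilon>\<^sup>2"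
    if "0 < \<epsilon>" for \<epsilon> m
  proof -
    define B where "B = (\<lambda>n. {\<omega>\<in>space M. \<exists>k\<le>n. m \<le> k \<and> \<epsilon> \<le> norm (S m k \<omega>)})"
    have "prob (B n) \<le> r m / \<epsilon>\<^sup>2" for n
    proof -
      \<comment> \<open>Dropping the first \<open>m\<close> terms turns the partial sums into the increments \<open>S m k\<close>.\<close>
      define a' where "a' = (\<lambda>p. if p < m then 0 else a p)"
      have S_eq: "S m k \<omega> = (\<Sum>p<k. X p \<omega> *\<^sub>R a' p)" for k \<omega>
        unfolding S_def by (rule sum.mono_neutral_cong_left) (auto simp: a'_def)
      have "prob (B n) \<le> prob {\<omega>\<in>space M. \<exists>k\<le>n. \<epsilon> \<le> norm (\<Sum>p<k. X p \<omega> *\<^sub>R a' p)}"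
        by (rule finite_measure_mono) (auto simp: B_def S_eq)
      also have "\<dots> \<le> (\<Sum>p<n. (norm (a' p))\<^sup>2) / \<epsilon>\<^sup>2"
        by (rule maximal_inequality[OF that])
      also have "(\<Sum>p<n. (norm (a' p))\<^sup>2) \<le> (\<Sum>p<n + m. (norm (a' p))\<^sup>2)"
        by (rule sum_mono2) auto
      also have "\<dots> = (\<Sum>p\<in>{m..<n + m}. (norm (a p))\<^sup>2)"
        by (rule sum.mono_neutral_cong_right) (auto simp: a'_def)
      also have "\<dots> = (\<Sum>p<n. (norm (a (p + m)))\<^sup>2)"
        using sum.shift_bounds_nat_ivl[of "\<lambda>p. (norm (a p))\<^sup>2" 0 m n]
        by (simp add: atLeast0LessThan)
      also have "\<dots> \<le> r m"
        unfolding r_def by (rule sum_le_suminf) (use assms summable_iff_shift[of "\<lambda>p. (norm (a p))\<^sup>2" m] in auto)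
      finally show ?thesis
        using that by (simp add: divide_right_mono)
    qed
    moreover have "(\<lambda>n. prob (B n)) \<longlonglongrightarrow> prob (\<Union>n. B n)"
      by (rule finite_Lim_measure_incseq) (auto simp: B_def incseq_def, meson le_trans)
    ultimately have "prob (\<Union>n. B n) \<le> r m / \<epsilon>\<^sup>2"
      by (intro LIMSEQ_le_const2) auto
    also have "(\<Union>n. B n) = {\<omega>\<in>space M. \<exists>k\<ge>m. \<epsilon> \<le> norm (S m k \<omega>)}"
      by (auto simp: B_def)
    finally show ?thesis .
  qed
  have "AE \<omega> in M. \<exists>m. \<forall>k\<ge>m. norm (S m k \<omega>) < \<epsilon>" if "0 < \<epsilon>" for \<epsilon>
  proof (rule AE_I)
    let ?N = "{\<omega>\<in>space M. \<forall>m. \<exists>k\<ge>m. \<epsilon> \<le> norm (S m k \<omega>)}"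
    show "?N \<in> events"
      by measurable
    show "{\<omega> \<in> space M. \<not> (\<exists>m. \<forall>k\<ge>m. norm (S m k \<omega>) < \<epsilon>)} \<subseteq> ?N"
      by (auto simp: not_less)
    have "prob ?N \<le> r m / \<epsilon>\<^sup>2" for m
      using tail[OF that, of m] by (rule order_trans[OF finite_measure_mono, rotated 2]) auto
    moreover have "(\<lambda>m. r m / \<epsilon>\<^sup>2) \<longlonglongrightarrow> 0 / \<epsilon>\<^sup>2"
      by (intro tendsto_intros r) (use that in simp)
    ultimately have "prob ?N \<le> 0"
      by (intro LIMSEQ_le_const) auto
    then show "emeasure M ?N = 0"
      by (simp add: emeasure_eq_measure measure_le_0_iff)
  qed
  then have "AE \<omega> in M. \<forall>i::nat. \<exists>m. \<forall>k\<ge>m. norm (S m k \<omega>) < 1 / real (Suc i)"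
    unfolding AE_all_countable by simp
  then show ?thesis
  proof (rule AE_mp, intro AE_I2 impI)
    fix \<omega> assume small: "\<forall>i::nat. \<exists>m. \<forall>k\<ge>m. norm (S m k \<omega>) < 1 / real (Suc i)"
    show "summable (\<lambda>p. X p \<omega> *\<^sub>R a p)"
      unfolding summable_Cauchy
    proof (intro allI impI)
      fix \<epsilon> :: real assume "0 < \<epsilon>"
      then obtain i where i: "1 / real (Suc i) < \<epsilon> / 2"
        by (metis half_gt_zero nat_approx_posE)
      obtain m where m: "\<And>k. k \<ge> m \<Longrightarrow> norm (S m k \<omega>) < 1 / real (Suc i)"
        using small by blast
      show "\<exists>N. \<forall>m\<ge>N. \<forall>n. norm (\<Sum>p\<in>{m..<n}. X p \<omega> *\<^sub>R a p) < \<epsilon>"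
      proof (intro exI allI impI)
        fix j n assume "j \<ge> m"
        show "norm (\<Sum>p\<in>{j..<n}. X p \<omega> *\<^sub>R a p) < \<epsilon>"
        proof (cases "j \<le> n")
          case True
          have "(\<Sum>p\<in>{j..<n}. X p \<omega> *\<^sub>R a p) = S m n \<omega> - S m j \<omega>"
            unfolding S_def using True \<open>j \<ge> m\<close>
            by (simp add: sum.atLeastLessThan_concat[of m j n, symmetric])
          also have "norm \<dots> \<le> norm (S m n \<omega>) + norm (S m j \<omega>)"
            by (rule norm_triangle_ineq4)
          also have "\<dots> < \<epsilon>"
            using m[of n] m[of j] True \<open>j \<ge> m\<close> i by linarith
          finally show ?thesis .
        qed (use \<open>0 < \<epsilon>\<close> in simp)
      qed
    qed
  qed
qed

text \<open>
  Fatou's lemma bounds the second moment of the remainders of the series. The lower bound loses a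
  factor \<open>2\<close>, which is harmless below, where only orders of magnitude count.
\<close>

lemma second_moment_noise_series:
  assumes c: "summable (\<lambda>p. (c p)\<^sup>2)"
    and Y: "AE \<omega> in M. (\<lambda>p. X p \<omega> * c p) sums Y \<omega>"
    and [measurable]: "Y \<in> borel_measurable M"
  shows "(\<integral>\<^sup>+\<omega>. ennreal ((Y \<omega>)\<^sup>2) \<partial>M) \<le> ennreal (\<Sum>p. (c p)\<^sup>2)"
    and "ennreal (\<Sum>p. (c p)\<^sup>2) \<le> 2 * (\<integral>\<^sup>+\<omega>. ennreal ((Y \<omega>)\<^sup>2) \<partial>M)"
proof -
  define S where "S = (\<lambda>n \<omega>. \<Sum>p<n. X p \<omega> * c p)"
  have [measurable]: "S n \<in> borel_measurable M" for n
    unfolding S_def by measurable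
  define r where "r = (\<lambda>m. \<Sum>p. (c (p + m))\<^sup>2)"
  have "r \<longlonglongrightarrow> 0"
    unfolding r_def using suminf_exist_split2[OF c] .
  have nn_sum: "(\<integral>\<^sup>+\<omega>. ennreal ((\<Sum>p\<in>I. X p \<omega> * c p)\<^sup>2) \<partial>M) = ennreal (\<Sum>p\<in>I. (c p)\<^sup>2)"
    if "finite I" for I
    using second_moment_finite_sum[OF that, of c] by (simp add: nn_integral_eq_integral)
  have remainder: "(\<integral>\<^sup>+\<omega>. ennreal ((Y \<omega> - S m \<omega>)\<^sup>2) \<partial>M) \<le> ennreal (r m)" for m
  proof -
    have "AE \<omega> in M. ennreal ((Y \<omega> - S m \<omega>)\<^sup>2) = liminf (\<lambda>n. ennreal ((S (n + m) \<omega> - S m \<omega>)\<^sup>2))"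
      using Y
    proof (rule AE_mp, intro AE_I2 impI)
      fix \<omega> assume "(\<lambda>p. X p \<omega> * c p) sums Y \<omega>"
      then have "(\<lambda>n. S (n + m) \<omega>) \<longlonglongrightarrow> Y \<omega>"
        unfolding sums_def S_def by (rule LIMSEQ_ignore_initial_segment)
      then have "(\<lambda>n. ennreal ((S (n + m) \<omega> - S m \<omega>)\<^sup>2)) \<longlonglongrightarrow> ennreal ((Y \<omega> - S m \<omega>)\<^sup>2)"
        by (intro tendsto_intros)
      then show "ennreal ((Y \<omega> - S m \<omega>)\<^sup>2) = liminf (\<lambda>n. ennreal ((S (n + m) \<omega> - S m \<omega>)\<^sup>2))"
        by (rule lim_imp_Liminf[OF sequentially_bot, symmetric])
    qed
    then have "(\<integral>\<^sup>+\<omega>. ennreal ((Y \<omega> - S m \<omega>)\<^sup>2) \<partial>M)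
        = (\<integral>\<^sup>+\<omega>. liminf (\<lambda>n. ennreal ((S (n + m) \<omega> - S m \<omega>)\<^sup>2)) \<partial>M)"
      by (rule nn_integral_cong_AE)
    also have "\<dots> \<le> liminf (\<lambda>n. \<integral>\<^sup>+\<omega>. ennreal ((S (n + m) \<omega> - S m \<omega>)\<^sup>2) \<partial>M)"
      by (rule nn_integral_liminf) measurable
    also have "\<dots> \<le> liminf (\<lambda>n::nat. ennreal (r m))"
    proof (rule Liminf_mono, rule always_eventually, rule allI)
      fix n
      have "S (n + m) \<omega> - S m \<omega> = (\<Sum>p\<in>{m..<n + m}. X p \<omega> * c p)" for \<omega>
        unfolding S_def by (simp add: sum_diff_nat_ivl atLeast0LessThan[symmetric])
      then have "(\<integral>\<^sup>+\<omega>. ennreal ((S (n + m) \<omega> - S m \<omega>)\<^sup>2) \<partial>M)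
          = ennreal (\<Sum>p\<in>{m..<n + m}. (c p)\<^sup>2)"
        by (simp add: nn_sum)
      also have "(\<Sum>p\<in>{m..<n + m}. (c p)\<^sup>2) = (\<Sum>p<n. (c (p + m))\<^sup>2)"
        using sum.shift_bounds_nat_ivl[of "\<lambda>p. (c p)\<^sup>2" 0 m n] by (simp add: atLeast0LessThan)
      also have "ennreal \<dots> \<le> ennreal (r m)"
        unfolding r_def
        by (intro ennreal_leI sum_le_suminf) (use c summable_iff_shift[of "\<lambda>p. (c p)\<^sup>2" m] in auto)
      finally show "(\<integral>\<^sup>+\<omega>. ennreal ((S (n + m) \<omega> - S m \<omega>)\<^sup>2) \<partial>M) \<le> ennreal (r m)" .
    qed
    also have "\<dots> = ennreal (r m)"
      by (simp add: Liminf_const)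
    finally show ?thesis .
  qed
  show "(\<integral>\<^sup>+\<omega>. ennreal ((Y \<omega>)\<^sup>2) \<partial>M) \<le> ennreal (\<Sum>p. (c p)\<^sup>2)"
    using remainder[of 0] by (simp add: S_def r_def)
  have approx: "ennreal (\<Sum>p<m. (c p)\<^sup>2) \<le> 2 * (\<integral>\<^sup>+\<omega>. ennreal ((Y \<omega>)\<^sup>2) \<partial>M) + 2 * ennreal (r m)" for m
  proof -
    have "ennreal ((S m \<omega>)\<^sup>2) \<le> 2 * ennreal ((Y \<omega>)\<^sup>2) + 2 * ennreal ((Y \<omega> - S m \<omega>)\<^sup>2)" for \<omega>
    proof -
      have "0 \<le> (2 * Y \<omega> - S m \<omega>)\<^sup>2"
        by simp
      then have "(S m \<omega>)\<^sup>2 \<le> 2 * (Y \<omega>)\<^sup>2 + 2 * (Y \<omega> - S m \<omega>)\<^sup>2"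
        by (simp add: power2_eq_square algebra_simps)
      then have "ennreal ((S m \<omega>)\<^sup>2) \<le> ennreal (2 * (Y \<omega>)\<^sup>2 + 2 * (Y \<omega> - S m \<omega>)\<^sup>2)"
        by (rule ennreal_leI)
      then show ?thesis
        by (simp add: ennreal_plus ennreal_mult)
    qed
    then have "(\<integral>\<^sup>+\<omega>. ennreal ((S m \<omega>)\<^sup>2) \<partial>M)
        \<le> (\<integral>\<^sup>+\<omega>. 2 * ennreal ((Y \<omega>)\<^sup>2) + 2 * ennreal ((Y \<omega> - S m \<omega>)\<^sup>2) \<partial>M)"
      by (intro nn_integral_mono)
    also have "\<dots> = 2 * (\<integral>\<^sup>+\<omega>. ennreal ((Y \<omega>)\<^sup>2) \<partial>M) + 2 * (\<integral>\<^sup>+\<omega>. ennreal ((Y \<omega> - S m \<omega>)\<^sup>2) \<partial>M)"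
      by (simp add: nn_integral_add nn_integral_cmult)
    also have "\<dots> \<le> 2 * (\<integral>\<^sup>+\<omega>. ennreal ((Y \<omega>)\<^sup>2) \<partial>M) + 2 * ennreal (r m)"
      by (intro add_left_mono mult_left_mono remainder) simp
    also have "(\<integral>\<^sup>+\<omega>. ennreal ((S m \<omega>)\<^sup>2) \<partial>M) = ennreal (\<Sum>p<m. (c p)\<^sup>2)"
      unfolding S_def by (rule nn_sum) simp
    finally show ?thesis .
  qed
  have "(\<lambda>m. ennreal (\<Sum>p<m. (c p)\<^sup>2)) \<longlonglongrightarrow> ennreal (\<Sum>p. (c p)\<^sup>2)"
    by (intro tendsto_ennrealI summable_LIMSEQ c)
  moreover have "(\<lambda>m. 2 * (\<integral>\<^sup>+\<omega>. ennreal ((Y \<omega>)\<^sup>2) \<partial>M) + 2 * ennreal (r m))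
      \<longlonglongrightarrow> 2 * (\<integral>\<^sup>+\<omega>. ennreal ((Y \<omega>)\<^sup>2) \<partial>M) + 2 * ennreal 0"
    by (intro tendsto_add tendsto_const ennreal_tendsto_cmult tendsto_ennrealI
        \<open>r \<longlonglongrightarrow> 0\<close>) simp
  ultimately have "ennreal (\<Sum>p. (c p)\<^sup>2) \<le> 2 * (\<integral>\<^sup>+\<omega>. ennreal ((Y \<omega>)\<^sup>2) \<partial>M) + 2 * ennreal 0"
    by (rule LIMSEQ_le) (use approx in auto)
  then show "ennreal (\<Sum>p. (c p)\<^sup>2) \<le> 2 * (\<integral>\<^sup>+\<omega>. ennreal ((Y \<omega>)\<^sup>2) \<partial>M)"
    by simp
qed

end

lemma white_noise_wiener_increments:
  assumes "prob_space M" and wiener: "independent_wiener_processes M \<beta>" and st: "0 \<le> s" "s < t"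
  shows "white_noise M (\<lambda>p \<omega>. (t - s) powr (- 1 / 2) * (\<beta> p t \<omega> - \<beta> p s \<omega>))"
proof -
  interpret prob_space M by fact
  let ?\<sigma> = "sqrt (t - s)"
  let ?X = "\<lambda>p \<omega>. (t - s) powr (- 1 / 2) * (\<beta> p t \<omega> - \<beta> p s \<omega>)"
  have indep: "indep_vars (\<lambda>_. borel) ?X UNIV"
  proof -
    have paths: "indep_vars (\<lambda>_. Pi\<^sub>M {0..} (\<lambda>_. borel))
        (\<lambda>p \<omega>. restrict (\<lambda>t. \<beta> p t \<omega>) {0..}) UNIV"
      using wiener by (simp add: independent_wiener_processes_def)
    have [measurable]: "(\<lambda>f. f t) \<in> borel_measurable (Pi\<^sub>M {0..} (\<lambda>_. borel :: real measure))"
      "(\<lambda>f. f s) \<in> borel_measurable (Pi\<^sub>M {0..} (\<lambda>_. borel :: real measure))"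
      using st by (auto intro: measurable_component_singleton)
    have "indep_vars (\<lambda>_. borel)
        (\<lambda>p \<omega>. (\<lambda>f. (t - s) powr (- 1 / 2) * (f t - f s)) (restrict (\<lambda>t. \<beta> p t \<omega>) {0..})) UNIV"
      by (rule indep_vars_compose2[OF paths]) measurable
    then show ?thesis
      using st by simp
  qed
  have \<sigma>: "0 < ?\<sigma>"
    using st by simp
  have D: "distributed M lborel (\<lambda>\<omega>. \<beta> p t \<omega> - \<beta> p s \<omega>) (normal_density 0 ?\<sigma>)" for p
    using wiener st by (simp add: independent_wiener_processes_def standard_wiener_process_def)
  have int1: "integrable M (\<lambda>\<omega>. \<beta> p t \<omega> - \<beta> p s \<omega>)" for p
    using integrable_normal_moment_nz_1[OF \<sigma>, of 0]
      distributed_integrable[OF D[of p], of "\<lambda>x. x"] by simp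
  have int2: "integrable M (\<lambda>\<omega>. (\<beta> p t \<omega> - \<beta> p s \<omega>)\<^sup>2)" for p
    using integrable_normal_moment[OF \<sigma>, of 0 2]
      distributed_integrable[OF D[of p], of "\<lambda>x. x\<^sup>2"] by simp
  have mean: "expectation (\<lambda>\<omega>. \<beta> p t \<omega> - \<beta> p s \<omega>) = 0" for p
    using normal_distributed_expectation[OF \<sigma> D] .
  have second: "expectation (\<lambda>\<omega>. (\<beta> p t \<omega> - \<beta> p s \<omega>)\<^sup>2) = t - s" for p
    using normal_distributed_variance[OF \<sigma> D[of p]] st unfolding mean by simp
  have scale: "((t - s) powr (- 1 / 2))\<^sup>2 * (t - s) = 1"
  proof -
    have "((t - s) powr (- 1 / 2))\<^sup>2 = (t - s) powr (- 1)"
      by (simp add: power2_eq_square powr_add[symmetric])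
    then show ?thesis
      using st by (simp add: powr_minus)
  qed
  show ?thesis
  proof
    show "indep_vars (\<lambda>_. borel) ?X UNIV" by (rule indep)
    fix p
    show "integrable M (?X p)"
      using int1 by simp
    show "integrable M (\<lambda>\<omega>. (?X p \<omega>)\<^sup>2)"
      using int2 by (simp add: power_mult_distrib)
    show "expectation (?X p) = 0"
      using mean by simp
    show "expectation (\<lambda>\<omega>. (?X p \<omega>)\<^sup>2) = 1"
      using second scale by (simp add: power_mult_distrib)
  qed
qed

section \<open>Second moments of stationary scalar recursions\<close>

text \<open>Convexity of the square: \<open>r * x + y\<close> is the mean of \<open>x\<close> and \<open>y / (1 - r)\<close> with weights
  \<open>r\<close> and \<open>1 - r\<close>.\<close>

lemma square_affine_le:
  fixes r x y :: real
  assumes "0 < r" "r < 1"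
  shows "(r * x + y)\<^sup>2 \<le> r * x\<^sup>2 + y\<^sup>2 / (1 - r)"
proof -
  have "(1 - r) * (r * x\<^sup>2 + y\<^sup>2 / (1 - r) - (r * x + y)\<^sup>2) = r * ((1 - r) * x - y)\<^sup>2"
    using assms by (simp add: field_simps power2_eq_square)
  also have "\<dots> \<ge> 0"
    using assms by simp
  finally show ?thesis
    using assms by (simp add: zero_le_mult_iff)
qed

text \<open>
  Truncation makes the second moment of the unknown stationary law finite a priori. Stationarity
  and convexity of the square give \<open>G c \<le> G (c * r) + c * \<sigma> / (1 - r)\<close> for the truncated moment
  \<open>G c = \<integral> min (c * x\<^sup>2) K\<close>. This is iterated, and \<open>G (r ^ n)\<close> tends to \<open>0\<close> by dominated
  convergence.
\<close>

lemma stationary_second_moment: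
  fixes x y :: "'w \<Rightarrow> real"
  assumes "prob_space N" and [measurable]: "x \<in> borel_measurable N" "y \<in> borel_measurable N"
    and r: "0 < r" "r < 1" and "0 \<le> \<sigma>"
    and y: "(\<integral>\<^sup>+\<omega>. ennreal ((y \<omega>)\<^sup>2) \<partial>N) \<le> ennreal \<sigma>"
    and stationary: "distr N borel x = distr N borel (\<lambda>\<omega>. r * x \<omega> + y \<omega>)"
  shows "(\<integral>\<^sup>+\<omega>. ennreal ((x \<omega>)\<^sup>2) \<partial>N) \<le> ennreal (\<sigma> / (1 - r)\<^sup>2)"
proof -
  interpret prob_space N by fact
  define G where "G = (\<lambda>c K. \<integral>\<^sup>+\<omega>. ennreal (min (c * (x \<omega>)\<^sup>2) K) \<partial>N)"
  have step: "G c K \<le> G (c * r) K + ennreal (c * \<sigma> / (1 - r))" if "0 \<le> c" "0 \<le> K" for c K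
  proof -
    have f: "(\<lambda>z::real. ennreal (min (c * z\<^sup>2) K)) \<in> borel_measurable borel"
      by measurable
    have "G c K = (\<integral>\<^sup>+z. ennreal (min (c * z\<^sup>2) K) \<partial>distr N borel x)"
      unfolding G_def by (subst nn_integral_distr) auto
    also have "\<dots> = (\<integral>\<^sup>+\<omega>. ennreal (min (c * (r * x \<omega> + y \<omega>)\<^sup>2) K) \<partial>N)"
      unfolding stationary by (subst nn_integral_distr) auto
    also have "\<dots> \<le> (\<integral>\<^sup>+\<omega>. ennreal (min (c * r * (x \<omega>)\<^sup>2) K)
        + ennreal (c / (1 - r)) * ennreal ((y \<omega>)\<^sup>2) \<partial>N)"
    proof (rule nn_integral_mono)
      fix \<omega>
      have "c * (r * x \<omega> + y \<omega>)\<^sup>2 \<le> c * (r * (x \<omega>)\<^sup>2 + (y \<omega>)\<^sup>2 / (1 - r))"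
        by (intro mult_left_mono square_affine_le r that)
      also have "\<dots> = c * r * (x \<omega>)\<^sup>2 + c / (1 - r) * (y \<omega>)\<^sup>2"
        by (simp add: algebra_simps)
      finally have "min (c * (r * x \<omega> + y \<omega>)\<^sup>2) K
          \<le> min (c * r * (x \<omega>)\<^sup>2) K + c / (1 - r) * (y \<omega>)\<^sup>2"
        using r that mult_nonneg_nonneg[of "c / (1 - r)" "(y \<omega>)\<^sup>2"]
        unfolding min_def by (auto simp del: mult_nonneg_nonneg)
      then have "ennreal (min (c * (r * x \<omega> + y \<omega>)\<^sup>2) K)
          \<le> ennreal (min (c * r * (x \<omega>)\<^sup>2) K + c / (1 - r) * (y \<omega>)\<^sup>2)"
        by (rule ennreal_leI)
      also have "\<dots> = ennreal (min (c * r * (x \<omega>)\<^sup>2) K) + ennreal (c / (1 - r)) * ennreal ((y \<omega>)\<^sup>2)"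
        using r that by (subst ennreal_plus) (auto simp: ennreal_mult[symmetric])
      finally show "ennreal (min (c * (r * x \<omega> + y \<omega>)\<^sup>2) K)
          \<le> ennreal (min (c * r * (x \<omega>)\<^sup>2) K) + ennreal (c / (1 - r)) * ennreal ((y \<omega>)\<^sup>2)" .
    qed
    also have "\<dots> = G (c * r) K + ennreal (c / (1 - r)) * (\<integral>\<^sup>+\<omega>. ennreal ((y \<omega>)\<^sup>2) \<partial>N)"
      unfolding G_def by (subst nn_integral_add) (auto simp: nn_integral_cmult)
    also have "\<dots> \<le> G (c * r) K + ennreal (c / (1 - r)) * ennreal \<sigma>"
      by (intro add_left_mono mult_left_mono y) simp
    also have "\<dots> = G (c * r) K + ennreal (c * \<sigma> / (1 - r))"
      using r that \<open>0 \<le> \<sigma>\<close> by (simp add: ennreal_mult[symmetric])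
    finally show ?thesis .
  qed
  have iterate: "G 1 K \<le> G (r ^ n) K + ennreal (\<sigma> / (1 - r) * (\<Sum>k<n. r ^ k))" if "0 \<le> K" for K n
  proof (induction n)
    case 0
    then show ?case by simp
  next
    case (Suc n)
    have "G (r ^ n) K \<le> G (r ^ Suc n) K + ennreal (\<sigma> / (1 - r) * r ^ n)"
      using step[of "r ^ n" K] r that by (simp add: mult.commute)
    then have "G 1 K \<le> G (r ^ Suc n) K + ennreal (\<sigma> / (1 - r) * r ^ n)
        + ennreal (\<sigma> / (1 - r) * (\<Sum>k<n. r ^ k))"
      using Suc.IH by (meson add_right_mono order_trans)
    also have "\<dots> = G (r ^ Suc n) K + ennreal (\<sigma> / (1 - r) * (\<Sum>k<Suc n. r ^ k))"
      using r \<open>0 \<le> \<sigma>\<close>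
      by (simp add: add.assoc ennreal_plus[symmetric] sum_nonneg distrib_left add.commute
          del: ennreal_plus)
    finally show ?case .
  qed
  have truncated: "G 1 K \<le> ennreal (\<sigma> / (1 - r)\<^sup>2)" if "0 \<le> K" for K
  proof -
    have "(\<lambda>n. G (r ^ n) K) \<longlonglongrightarrow> (\<integral>\<^sup>+\<omega>. 0 \<partial>N)"
      unfolding G_def
    proof (rule nn_integral_dominated_convergence[where w="\<lambda>_. ennreal K"])
      show "AE \<omega> in N. (\<lambda>n. ennreal (min (r ^ n * (x \<omega>)\<^sup>2) K)) \<longlonglongrightarrow> 0"
      proof (rule AE_I2)
        fix \<omega>
        have "(\<lambda>n. ennreal (min (r ^ n * (x \<omega>)\<^sup>2) K)) \<longlonglongrightarrow> ennreal (min (0 * (x \<omega>)\<^sup>2) K)"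
          using r by (intro tendsto_ennrealI tendsto_min tendsto_mult LIMSEQ_power_zero tendsto_const) auto
        then show "(\<lambda>n. ennreal (min (r ^ n * (x \<omega>)\<^sup>2) K)) \<longlonglongrightarrow> 0"
          using that by simp
      qed
      show "AE \<omega> in N. ennreal (min (r ^ n * (x \<omega>)\<^sup>2) K) \<le> ennreal K" for n
        by (intro AE_I2 ennreal_leI) simp
    qed (auto simp: emeasure_space_1)
    then have "(\<lambda>n. G (r ^ n) K + ennreal (\<sigma> / (1 - r)\<^sup>2)) \<longlonglongrightarrow> 0 + ennreal (\<sigma> / (1 - r)\<^sup>2)"
      by (intro tendsto_intros) simp
    moreover have "G 1 K \<le> G (r ^ n) K + ennreal (\<sigma> / (1 - r)\<^sup>2)" for n
    proof -
      have "(\<Sum>k<n. r ^ k) \<le> (\<Sum>k. r ^ k)"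
        using r by (intro sum_le_suminf summable_geometric) auto
      also have "\<dots> = 1 / (1 - r)"
        using r by (simp add: suminf_geometric)
      finally have "\<sigma> / (1 - r) * (\<Sum>k<n. r ^ k) \<le> \<sigma> / (1 - r) * (1 / (1 - r))"
        using r \<open>0 \<le> \<sigma>\<close> by (intro mult_left_mono) auto
      then have "ennreal (\<sigma> / (1 - r) * (\<Sum>k<n. r ^ k)) \<le> ennreal (\<sigma> / (1 - r)\<^sup>2)"
        by (intro ennreal_leI) (simp add: power2_eq_square)
      then show ?thesis
        using iterate[OF that, of n] by (meson add_left_mono order_trans)
    qed
    ultimately have "G 1 K \<le> 0 + ennreal (\<sigma> / (1 - r)\<^sup>2)"
      by (intro LIMSEQ_le_const) auto
    then show ?thesis by simp
  qed
  have "(\<integral>\<^sup>+\<omega>. ennreal ((x \<omega>)\<^sup>2) \<partial>N)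
      = (\<integral>\<^sup>+\<omega>. liminf (\<lambda>n. ennreal (min (1 * (x \<omega>)\<^sup>2) (real n))) \<partial>N)"
  proof (rule nn_integral_cong)
    fix \<omega>
    have "(\<lambda>n. ennreal (min (1 * (x \<omega>)\<^sup>2) (real n))) \<longlonglongrightarrow> ennreal ((x \<omega>)\<^sup>2)"
    proof (rule tendsto_eventually)
      show "\<forall>\<^sub>F n in sequentially. ennreal (min (1 * (x \<omega>)\<^sup>2) (real n)) = ennreal ((x \<omega>)\<^sup>2)"
        using eventually_ge_at_top[of "nat \<lceil>(x \<omega>)\<^sup>2\<rceil>"]
        by eventually_elim (auto simp: min_def nat_le_iff ceiling_le_iff)
    qed
    then show "ennreal ((x \<omega>)\<^sup>2) = liminf (\<lambda>n. ennreal (min (1 * (x \<omega>)\<^sup>2) (real n)))"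
      by (rule lim_imp_Liminf[OF sequentially_bot, symmetric])
  qed
  also have "\<dots> \<le> liminf (\<lambda>n. G 1 (real n))"
    unfolding G_def by (rule nn_integral_liminf) measurable
  also have "\<dots> \<le> liminf (\<lambda>n::nat. ennreal (\<sigma> / (1 - r)\<^sup>2))"
    by (intro Liminf_mono always_eventually allI truncated) simp
  also have "\<dots> = ennreal (\<sigma> / (1 - r)\<^sup>2)"
    by (simp add: Liminf_const)
  finally show ?thesis .
qed

section \<open>Regularity exponents\<close>

lemma suminf_ennreal_finite_iff:
  assumes "\<And>p. 0 \<le> f p"
  shows "(\<Sum>p. ennreal (f p)) < \<infinity> \<longleftrightarrow> summable f"
proof
  assume "(\<Sum>p. ennreal (f p)) < \<infinity>"
  then show "summable f"
    by (intro summable_suminf_not_top assms) auto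
next
  assume "summable f"
  then show "(\<Sum>p. ennreal (f p)) < \<infinity>"
    by (simp add: suminf_ennreal2[OF assms])
qed

lemma ennreal_square_add_le: "ennreal ((x + y)\<^sup>2) \<le> 2 * ennreal (x\<^sup>2) + 2 * ennreal (y\<^sup>2)"
proof -
  have "0 \<le> (x - y)\<^sup>2" by simp
  then have "(x + y)\<^sup>2 \<le> 2 * x\<^sup>2 + 2 * y\<^sup>2"
    by (simp add: power2_eq_square algebra_simps)
  then have "ennreal ((x + y)\<^sup>2) \<le> ennreal (2 * x\<^sup>2 + 2 * y\<^sup>2)"
    by (rule ennreal_leI)
  then show ?thesis
    by (simp add: ennreal_plus ennreal_mult)
qed

context diagonal_operator
begin

lemma nn_integral_norm_sq:
  assumes "sets \<mu> = sets borel"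
  shows "(\<integral>\<^sup>+u. norm_sq e lam s u \<partial>\<mu>)
    = (\<Sum>p. ennreal (lam p powr s) * (\<integral>\<^sup>+u. ennreal ((u \<bullet> e p)\<^sup>2) \<partial>\<mu>))"
proof -
  have [measurable]: "(\<lambda>u. u \<bullet> e p) \<in> borel_measurable \<mu>" for p
    using assms by (simp add: measurable_cong_sets[OF assms refl])
  show ?thesis
    by (simp add: norm_sq_def nn_integral_suminf ennreal_mult nn_integral_cmult)
qed

lemma trace_diagonal:
  assumes Q: "\<And>p. Q (e p) = q p *\<^sub>R e p"
  shows "trace_op e (frac_power e lam r \<circ> Q) = (\<Sum>p. ennreal (q p * lam p powr r))"
proof -
  have "frac_power e lam r (Q (e p)) \<bullet> e p = q p * lam p powr r" for p
  proof -
    have "frac_power e lam r (Q (e p))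
        = (\<Sum>j. if j = p then (lam j powr r * q p) *\<^sub>R e j else 0)"
      unfolding frac_power_def by (rule suminf_cong) (simp add: Q)
    also have "\<dots> = (lam p powr r * q p) *\<^sub>R e p"
      using sums_single[of p "\<lambda>j. (lam j powr r * q p) *\<^sub>R e j"] by (simp add: sums_iff)
    finally show ?thesis by simp
  qed
  then show ?thesis
    by (simp add: trace_op_def)
qed

lemma summable_powr_antimono:
  assumes q: "\<And>p. 0 \<le> q p" and "s \<le> s'" and summ: "summable (\<lambda>p. q p * lam p powr s')"
  shows "summable (\<lambda>p. q p * lam p powr s)"
proof (rule summable_comparison_test_ev[OF always_eventually])
  show "summable (\<lambda>p. lam 0 powr (s - s') * (q p * lam p powr s'))"
    using summ by (rule summable_mult)
  show "\<forall>p. norm (q p * lam p powr s) \<le> lam 0 powr (s - s') * (q p * lam p powr s')"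
  proof
    fix p
    have "lam p powr s = lam p powr (s - s') * lam p powr s'"
      by (simp add: powr_add[symmetric])
    moreover have "lam p powr (s - s') \<le> lam 0 powr (s - s')"
      using assms(2) eigenvalue_0_pos eigenvalue_ge_first by (intro powr_mono2') auto
    ultimately have "lam p powr s \<le> lam 0 powr (s - s') * lam p powr s'"
      by (simp add: mult_right_mono)
    then have "q p * lam p powr s \<le> q p * (lam 0 powr (s - s') * lam p powr s')"
      using q by (rule mult_left_mono)
    then show "norm (q p * lam p powr s) \<le> lam 0 powr (s - s') * (q p * lam p powr s')"
      using q by (simp add: mult_ac)
  qed
qed

end

locale trace_class_noise = diagonal_operator e D A lam
  for e :: "nat \<Rightarrow> 'a::{real_inner, banach, second_countable_topology}"
    and D :: "'a set" and A :: "'a \<Rightarrow> 'a" and lam :: "nat \<Rightarrow> real" +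
  fixes Q :: "'a \<Rightarrow> 'a" and q :: "nat \<Rightarrow> real"
  assumes Q_bounded: "bounded_linear Q"
    and Q_eigen: "\<And>p. Q (e p) = q p *\<^sub>R e p"
    and q_nonneg: "\<And>p. 0 \<le> q p"
    and trace_condition: "0 < s_bar e lam Q"
    and not_truncated: "\<And>s::real. 1 < s \<Longrightarrow> trace_op e (frac_power e lam (-1 + s) \<circ> Q) = \<infinity>"
begin

lemma trace_finite_iff:
  "trace_op e (frac_power e lam r \<circ> Q) < \<infinity> \<longleftrightarrow> summable (\<lambda>p. q p * lam p powr r)"
  unfolding trace_diagonal[OF Q_eigen] by (rule suminf_ennreal_finite_iff) (simp add: q_nonneg)

lemma s_bar_eq: "s_bar e lam Q = Sup {ereal s | s. 0 < s \<and> s < 1 \<and> summable (\<lambda>p. q p * lam p powr (-1 + s))}"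
  unfolding s_bar_def trace_finite_iff ..

lemma summable_div_eigenvalues: "summable (\<lambda>p. q p / lam p)"
proof -
  obtain s where "0 < s" and s: "summable (\<lambda>p. q p * lam p powr (-1 + s))"
    using trace_condition unfolding s_bar_eq less_Sup_iff by auto
  have "summable (\<lambda>p. q p * lam p powr (-1))"
    by (rule summable_powr_antimono[OF q_nonneg _ s]) (use \<open>0 < s\<close> in simp)
  then show ?thesis
    by (simp add: powr_minus divide_inverse less_imp_le)
qed

text \<open>
  The exponent \<open>1\<close> may have finite trace, but it is excluded from the definition of \<open>s_bar\<close>. By
  monotonicity all exponents in \<open>(0, 1)\<close> then have finite trace too, so \<open>s_bar\<close> is \<open>1\<close> all the same.
\<close>

lemma Sup_trace_exponents:
  "Sup {ereal s | s. summable (\<lambda>p. q p * lam p powr (s - t))} = s_bar e lam Q + ereal (t - 1)"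
proof (rule Sup_eqI)
  have below: "ereal s \<le> s_bar e lam Q" if "summable (\<lambda>p. q p * lam p powr (-1 + s))" for s
  proof -
    have "trace_op e (frac_power e lam (-1 + s) \<circ> Q) \<noteq> \<infinity>"
      using trace_finite_iff[of "-1 + s"] that by (simp add: less_top)
    then have "s \<le> 1"
      using not_truncated[of s] by (meson not_less)
    have le: "ereal x \<le> s_bar e lam Q" if "x < s" "x < 1" for x
    proof (cases "0 < x")
      case True
      have "summable (\<lambda>p. q p * lam p powr (-1 + x))"
        by (rule summable_powr_antimono[OF q_nonneg _ \<open>summable (\<lambda>p. q p * lam p powr (-1 + s))\<close>])
           (use \<open>x < s\<close> in simp)
      then show ?thesis
        unfolding s_bar_eq using True \<open>x < 1\<close> by (intro Sup_upper) auto
    next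
      case False
      then show ?thesis
        using trace_condition order_trans[of "ereal x" 0 "s_bar e lam Q"] by simp
    qed
    show ?thesis
    proof (rule dense_le)
      fix y assume "y < ereal s"
      then obtain x where x: "y < ereal x" "ereal x < ereal s"
        using ereal_dense2 by blast
      then have "ereal x \<le> s_bar e lam Q"
        using le[of x] \<open>s \<le> 1\<close> by simp
      with x(1) show "y \<le> s_bar e lam Q"
        by (meson less_imp_le order_trans)
    qed
  qed
  fix y assume "y \<in> {ereal s | s. summable (\<lambda>p. q p * lam p powr (s - t))}"
  then obtain s where s: "y = ereal s" "summable (\<lambda>p. q p * lam p powr (s - t))"
    by blast
  have "s - t = -1 + (s - t + 1)" by simp
  then have "ereal (s - t + 1) \<le> s_bar e lam Q"
    using s(2) below[of "s - t + 1"] by simp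
  then have "ereal (s - t + 1) + ereal (t - 1) \<le> s_bar e lam Q + ereal (t - 1)"
    by (rule add_right_mono)
  then show "y \<le> s_bar e lam Q + ereal (t - 1)"
    by (simp add: s(1))
next
  fix y assume y: "\<And>z. z \<in> {ereal s | s. summable (\<lambda>p. q p * lam p powr (s - t))} \<Longrightarrow> z \<le> y"
  have "s_bar e lam Q \<le> y - ereal (t - 1)"
    unfolding s_bar_eq
  proof (rule Sup_least)
    fix z assume "z \<in> {ereal s | s. 0 < s \<and> s < 1 \<and> summable (\<lambda>p. q p * lam p powr (-1 + s))}"
    then obtain s where s: "z = ereal s" "summable (\<lambda>p. q p * lam p powr (-1 + s))"
      by blast
    have "-1 + s = (s + (t - 1)) - t" by simp
    with s(2) have "ereal (s + (t - 1)) \<le> y"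
      by (intro y) auto
    then show "z \<le> y - ereal (t - 1)"
      by (simp add: s(1) ereal_le_minus)
  qed
  then show "s_bar e lam Q + ereal (t - 1) \<le> y"
    by (simp add: ereal_le_minus)
qed

text \<open>
  Second moments of the coefficients of order \<open>q p * lam p powr -t\<close> give the regularity
  \<open>s_bar + t - 1\<close>. In the lower bound an error of smaller order is allowed: since \<open>lam p\<close> tends to
  infinity, it is absorbed by the left-hand side for all but finitely many \<open>p\<close>.
\<close>

lemma reg_eqI:
  assumes sets: "sets \<mu> = sets borel" and "0 < \<delta>" and "0 \<le> C"
    and upper: "\<And>p. (\<integral>\<^sup>+u. ennreal ((u \<bullet> e p)\<^sup>2) \<partial>\<mu>) \<le> ennreal (C * (q p * lam p powr (- t)))"
    and lower: "\<And>p. ennreal (q p * lam p powr (- t)) \<le> ennreal C *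
      ((\<integral>\<^sup>+u. ennreal ((u \<bullet> e p)\<^sup>2) \<partial>\<mu>) + ennreal (q p * lam p powr (- t - \<delta>)))"
  shows "reg e lam \<mu> = s_bar e lam Q + ereal (t - 1)"
proof -
  define m where "m = (\<lambda>p. enn2real (\<integral>\<^sup>+u. ennreal ((u \<bullet> e p)\<^sup>2) \<partial>\<mu>))"
  have m_eq: "(\<integral>\<^sup>+u. ennreal ((u \<bullet> e p)\<^sup>2) \<partial>\<mu>) = ennreal (m p)" for p
    unfolding m_def using upper[of p]
    by (intro ennreal_enn2real[symmetric]) (metis ennreal_less_top order_le_less_trans)
  have m_nonneg: "0 \<le> m p" for p
    by (simp add: m_def)
  have up: "m p \<le> C * (q p * lam p powr (- t))" for p
    using upper[of p] \<open>0 \<le> C\<close> q_nonneg[of p] by (simp add: m_eq)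
  have low: "q p * lam p powr (- t) \<le> C * (m p + q p * lam p powr (- t - \<delta>))" for p
    using lower[of p] \<open>0 \<le> C\<close> q_nonneg[of p] m_nonneg[of p]
    by (simp add: m_eq ennreal_plus[symmetric] ennreal_mult[symmetric] del: ennreal_plus)
  have "(\<lambda>p. C * lam p powr (- \<delta>)) \<longlonglongrightarrow> C * 0"
    by (intro tendsto_mult tendsto_const tendsto_neg_powr eigenvalues_at_top) (use \<open>0 < \<delta>\<close> in simp)
  then have "\<forall>\<^sub>F p in sequentially. C * lam p powr (- \<delta>) < 1 / 2"
    by (rule order_tendstoD) simp
  then have absorbed: "\<forall>\<^sub>F p in sequentially. q p * lam p powr (- t) \<le> 2 * C * m p"
  proof eventually_elim
    case (elim p)
    let ?w = "q p * lam p powr (- t)"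
    have "q p * lam p powr (- t - \<delta>) = ?w * lam p powr (- \<delta>)"
      by (simp add: powr_add[symmetric] mult.assoc)
    then have "?w \<le> C * m p + ?w * (C * lam p powr (- \<delta>))"
      using low[of p] by (simp only: distrib_left mult_ac)
    also have "?w * (C * lam p powr (- \<delta>)) \<le> ?w * (1 / 2)"
      using elim q_nonneg[of p] by (intro mult_left_mono) auto
    finally show ?case by simp
  qed
  have "(\<integral>\<^sup>+u. norm_sq e lam s u \<partial>\<mu>) < \<infinity> \<longleftrightarrow> summable (\<lambda>p. q p * lam p powr (s - t))" for s
  proof -
    have powr_eq: "lam p powr (s - t) = lam p powr s * lam p powr (- t)" for p
      by (simp add: powr_add[symmetric])
    have "(\<integral>\<^sup>+u. norm_sq e lam s u \<partial>\<mu>) = (\<Sum>p. ennreal (lam p powr s * m p))"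
      unfolding nn_integral_norm_sq[OF sets] m_eq by (simp add: ennreal_mult m_nonneg)
    then have "(\<integral>\<^sup>+u. norm_sq e lam s u \<partial>\<mu>) < \<infinity> \<longleftrightarrow> summable (\<lambda>p. lam p powr s * m p)"
      by (simp only:) (rule suminf_ennreal_finite_iff, simp add: m_nonneg)
    also have "\<dots> \<longleftrightarrow> summable (\<lambda>p. q p * lam p powr (s - t))"
    proof
      assume "summable (\<lambda>p. lam p powr s * m p)"
      then have "summable (\<lambda>p. 2 * C * (lam p powr s * m p))"
        by (rule summable_mult)
      moreover have "\<forall>\<^sub>F p in sequentially.
          norm (q p * lam p powr (s - t)) \<le> 2 * C * (lam p powr s * m p)"
        using absorbed
      proof eventually_elim
        case (elim p)
        then have "lam p powr s * (q p * lam p powr (- t)) \<le> lam p powr s * (2 * C * m p)"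
          by (intro mult_left_mono) auto
        then show ?case
          using q_nonneg[of p] by (simp add: powr_eq mult_ac)
      qed
      ultimately show "summable (\<lambda>p. q p * lam p powr (s - t))"
        by (rule summable_comparison_test_ev[rotated])
    next
      assume "summable (\<lambda>p. q p * lam p powr (s - t))"
      then have "summable (\<lambda>p. C * (q p * lam p powr (s - t)))"
        by (rule summable_mult)
      moreover have "\<forall>p. norm (lam p powr s * m p) \<le> C * (q p * lam p powr (s - t))"
      proof
        fix p
        have "lam p powr s * m p \<le> lam p powr s * (C * (q p * lam p powr (- t)))"
          by (intro mult_left_mono up) simp
        then show "norm (lam p powr s * m p) \<le> C * (q p * lam p powr (s - t))"
          using m_nonneg[of p] by (simp add: powr_eq mult_ac)
      qed
      ultimately show "summable (\<lambda>p. lam p powr s * m p)"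
        by (rule summable_comparison_test_ev[OF always_eventually, rotated])
    qed
    finally show ?thesis .
  qed
  then show ?thesis
    unfolding reg_def by (simp only: Sup_trace_exponents)
qed

end

section \<open>Kernels driven by a noise space\<close>

lemma (in prob_space) distr_pair_snd_prob:
  assumes "prob_space \<nu>"
  shows "distr (\<nu> \<Otimes>\<^sub>M M) M snd = M"
proof (rule measure_eqI)
  interpret \<nu>: prob_space \<nu> by fact
  fix X assume "X \<in> sets (distr (\<nu> \<Otimes>\<^sub>M M) M snd)"
  then have X: "X \<in> sets M" by simp
  then have "emeasure (distr (\<nu> \<Otimes>\<^sub>M M) M snd) X = emeasure (\<nu> \<Otimes>\<^sub>M M) (space \<nu> \<times> X)"
    using sets.sets_into_space[OF X]
    by (subst emeasure_distr) (auto intro!: arg_cong[where f="emeasure _"] simp: space_pair_measure)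
  also have "\<dots> = emeasure M X"
    using X by (simp add: emeasure_pair_measure_Times \<nu>.emeasure_space_1)
  finally show "emeasure (distr (\<nu> \<Otimes>\<^sub>M M) M snd) X = emeasure M X" .
qed simp

lemma (in prob_space) distr_kernel_measurable:
  assumes "case_prod G \<in> measurable (L \<Otimes>\<^sub>M M) R"
  shows "(\<lambda>v. distr M R (G v)) \<in> measurable L (subprob_algebra R)"
  by (rule measurable_distr2[OF assms])
     (auto intro!: measurable_const simp: space_subprob_algebra prob_space_imp_subprob_space prob_space_axioms)

lemma (in prob_space) bind_distr_eq_distr_pair:
  assumes "prob_space \<nu>" and [measurable]: "case_prod G \<in> measurable (\<nu> \<Otimes>\<^sub>M M) R"
  shows "\<nu> \<bind> (\<lambda>v. distr M R (G v)) = distr (\<nu> \<Otimes>\<^sub>M M) R (case_prod G)"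
proof (rule measure_eqI)
  interpret \<nu>: prob_space \<nu> by fact
  have ne: "space \<nu> \<noteq> {}" by (rule \<nu>.not_empty)
  have K: "(\<lambda>v. distr M R (G v)) \<in> measurable \<nu> (subprob_algebra R)"
    by (rule distr_kernel_measurable[OF assms(2)])
  show sets: "sets (\<nu> \<bind> (\<lambda>v. distr M R (G v))) = sets (distr (\<nu> \<Otimes>\<^sub>M M) R (case_prod G))"
    using sets_bind[of \<nu> "\<lambda>v. distr M R (G v)" R] ne by simp
  fix X assume "X \<in> sets (\<nu> \<bind> (\<lambda>v. distr M R (G v)))"
  then have X[measurable]: "X \<in> sets R" by (simp add: sets)
  have "emeasure (\<nu> \<bind> (\<lambda>v. distr M R (G v))) X = (\<integral>\<^sup>+v. emeasure (distr M R (G v)) X \<partial>\<nu>)"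
    by (rule emeasure_bind[OF ne K X])
  also have "\<dots> = (\<integral>\<^sup>+v. \<integral>\<^sup>+\<omega>. indicator X (G v \<omega>) \<partial>M \<partial>\<nu>)"
  proof (rule nn_integral_cong)
    fix v assume "v \<in> space \<nu>"
    then have "G v \<in> measurable M R"
      using measurable_Pair2[OF assms(2)] by simp
    then show "emeasure (distr M R (G v)) X = (\<integral>\<^sup>+\<omega>. indicator X (G v \<omega>) \<partial>M)"
      by (subst nn_integral_indicator[symmetric], simp, subst nn_integral_distr) auto
  qed
  also have "\<dots> = (\<integral>\<^sup>+z. indicator X (case_prod G z) \<partial>(\<nu> \<Otimes>\<^sub>M M))"
    by (subst nn_integral_fst[symmetric]) (auto simp: case_prod_beta')
  also have "\<dots> = emeasure (distr (\<nu> \<Otimes>\<^sub>M M) R (case_prod G)) X"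
    by (subst nn_integral_indicator[symmetric], simp, subst nn_integral_distr) auto
  finally show "emeasure (\<nu> \<bind> (\<lambda>v. distr M R (G v))) X
    = emeasure (distr (\<nu> \<Otimes>\<^sub>M M) R (case_prod G)) X" .
qed

section \<open>Operators applied to the noise\<close>

locale noise_input = trace_class_noise e D A lam Q q + prob_space M
  for e :: "nat \<Rightarrow> 'a::{real_inner, banach, second_countable_topology}"
    and D :: "'a set" and A :: "'a \<Rightarrow> 'a" and lam :: "nat \<Rightarrow> real"
    and Q :: "'a \<Rightarrow> 'a" and q :: "nat \<Rightarrow> real" and M :: "'w measure" +
  fixes \<xi> :: "nat \<Rightarrow> 'w \<Rightarrow> nat \<Rightarrow> real" and h :: real
  assumes normalised_noise:
      "\<And>k. \<exists>X. white_noise M X \<and> (\<forall>\<omega> p. \<xi> k \<omega> p = sqrt (q p) * X p \<omega>)"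
    and h_pos: "0 < h"
begin

lemma xi_measurable [measurable]: "(\<lambda>\<omega>. \<xi> k \<omega> p) \<in> borel_measurable M"
proof -
  obtain X where X: "white_noise M X" "\<And>\<omega> p. \<xi> k \<omega> p = sqrt (q p) * X p \<omega>"
    using normalised_noise by blast
  interpret white_noise M X by fact
  show ?thesis unfolding X(2) by measurable
qed

lemma xi_copy_measurable [measurable (raw)]:
  assumes "Z \<in> measurable N M"
  shows "(\<lambda>z. \<xi> k (Z z) p) \<in> borel_measurable N"
  using measurable_compose[OF assms xi_measurable] .

lemma second_moment_xi: "(\<integral>\<^sup>+\<omega>. ennreal ((\<xi> k \<omega> p)\<^sup>2) \<partial>M) = ennreal (q p)"
proof -
  obtain X where X: "white_noise M X" "\<And>\<omega> p. \<xi> k \<omega> p = sqrt (q p) * X p \<omega>"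
    using normalised_noise by blast
  interpret white_noise M X by fact
  have "(\<integral>\<^sup>+\<omega>. ennreal ((\<xi> k \<omega> p)\<^sup>2) \<partial>M) = ennreal (expectation (\<lambda>\<omega>. q p * (X p \<omega>)\<^sup>2))"
    using integrable_noise_square[of p] q_nonneg[of p]
    by (subst nn_integral_eq_integral[symmetric]) (auto simp: X(2) power_mult_distrib)
  then show ?thesis
    by (simp add: expectation_noise_square)
qed

lemma apply_op_measurable [measurable]: "(\<lambda>\<omega>. apply_op e L (\<xi> k \<omega>)) \<in> borel_measurable M"
  unfolding apply_op_def by measurable

lemma AE_summable_operator_noise:
  fixes L :: "'a \<Rightarrow> 'a"
  assumes "summable (\<lambda>p. q p * (norm (L (e p)))\<^sup>2)"
  shows "AE \<omega> in M. summable (\<lambda>p. \<xi> k \<omega> p *\<^sub>R L (e p))"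
proof -
  obtain X where X: "white_noise M X" "\<And>\<omega> p. \<xi> k \<omega> p = sqrt (q p) * X p \<omega>"
    using normalised_noise by blast
  interpret white_noise M X by fact
  have "AE \<omega> in M. summable (\<lambda>p. X p \<omega> *\<^sub>R (sqrt (q p) *\<^sub>R L (e p)))"
    by (rule AE_summable_noise) (use assms q_nonneg in \<open>simp add: power_mult_distrib\<close>)
  then show ?thesis
    by (simp add: X(2) mult.commute)
qed

lemma second_moment_operator_noise:
  assumes summ: "summable (\<lambda>p. q p * (norm (L (e p)))\<^sup>2)"
    and V: "(\<lambda>p. q p * (L (e p) \<bullet> e i)\<^sup>2) sums V"
  shows "(\<integral>\<^sup>+\<omega>. ennreal ((apply_op e L (\<xi> k \<omega>) \<bullet> e i)\<^sup>2) \<partial>M) \<le> ennreal V"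
    and "ennreal V \<le> 2 * (\<integral>\<^sup>+\<omega>. ennreal ((apply_op e L (\<xi> k \<omega>) \<bullet> e i)\<^sup>2) \<partial>M)"
proof -
  obtain X where X: "white_noise M X" "\<And>\<omega> p. \<xi> k \<omega> p = sqrt (q p) * X p \<omega>"
    using normalised_noise by blast
  interpret white_noise M X by fact
  define c where "c = (\<lambda>p. sqrt (q p) * (L (e p) \<bullet> e i))"
  have c_sq: "(\<lambda>p. (c p)\<^sup>2) = (\<lambda>p. q p * (L (e p) \<bullet> e i)\<^sup>2)"
    using q_nonneg by (simp add: c_def power_mult_distrib)
  have c: "summable (\<lambda>p. (c p)\<^sup>2)" "(\<Sum>p. (c p)\<^sup>2) = V"
    using V unfolding c_sq by (simp_all add: sums_iff)
  have "AE \<omega> in M. (\<lambda>p. X p \<omega> * c p) sums (apply_op e L (\<xi> k \<omega>) \<bullet> e i)"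
    using AE_summable_operator_noise[OF summ, of k]
  proof (rule AE_mp, intro AE_I2 impI)
    fix \<omega> assume "summable (\<lambda>p. \<xi> k \<omega> p *\<^sub>R L (e p))"
    then have "(\<lambda>p. (\<xi> k \<omega> p *\<^sub>R L (e p)) \<bullet> e i) sums (apply_op e L (\<xi> k \<omega>) \<bullet> e i)"
      unfolding apply_op_def
      by (intro bounded_linear.sums[OF bounded_linear_inner_left] summable_sums)
    then show "(\<lambda>p. X p \<omega> * c p) sums (apply_op e L (\<xi> k \<omega>) \<bullet> e i)"
      by (simp add: X(2) c_def mult_ac)
  qed
  from second_moment_noise_series[OF c(1) this] c(2)
  show "(\<integral>\<^sup>+\<omega>. ennreal ((apply_op e L (\<xi> k \<omega>) \<bullet> e i)\<^sup>2) \<partial>M) \<le> ennreal V"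
    and "ennreal V \<le> 2 * (\<integral>\<^sup>+\<omega>. ennreal ((apply_op e L (\<xi> k \<omega>) \<bullet> e i)\<^sup>2) \<partial>M)"
    by simp_all
qed

lemma summable_div_affine_eigenvalues:
  assumes "0 < c"
  shows "summable (\<lambda>p. q p / (1 + c * lam p))"
proof (rule summable_comparison_test_ev[OF always_eventually])
  show "summable (\<lambda>p. 1 / c * (q p / lam p))"
    by (rule summable_mult[OF summable_div_eigenvalues])
  show "\<forall>p. norm (q p / (1 + c * lam p)) \<le> 1 / c * (q p / lam p)"
  proof
    fix p
    have "0 < c * lam p"
      using assms by simp
    then have "q p / (1 + c * lam p) \<le> q p / (c * lam p)"
      using q_nonneg by (intro divide_left_mono) auto
    then show "norm (q p / (1 + c * lam p)) \<le> 1 / c * (q p / lam p)"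
      using q_nonneg[of p] \<open>0 < c * lam p\<close> by simp
  qed
qed

lemma AE_summable_resolvent_noise:
  assumes "0 < c"
  shows "AE \<omega> in M. summable (\<lambda>p. (\<xi> k \<omega> p / (1 + c * lam p)) *\<^sub>R e p)"
proof -
  have "summable (\<lambda>p. q p * (norm (resolvent_op D A c (e p)))\<^sup>2)"
  proof (rule summable_comparison_test_ev[OF always_eventually])
    show "summable (\<lambda>p. q p / (1 + c * lam p))"
      by (rule summable_div_affine_eigenvalues[OF assms])
    show "\<forall>p. norm (q p * (norm (resolvent_op D A c (e p)))\<^sup>2) \<le> q p / (1 + c * lam p)"
    proof
      fix p
      have "0 < c * lam p"
        using assms by simp
      then have r: "0 < 1 + c * lam p" "1 / (1 + c * lam p) \<le> 1"
        by auto
      then have "(1 / (1 + c * lam p))\<^sup>2 \<le> 1 / (1 + c * lam p)"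
        unfolding power2_eq_square using mult_left_le[of "1 / (1 + c * lam p)" "1 / (1 + c * lam p)"]
        by simp
      then have "q p * (1 / (1 + c * lam p))\<^sup>2 \<le> q p * (1 / (1 + c * lam p))"
        using q_nonneg by (intro mult_left_mono) auto
      then show "norm (q p * (norm (resolvent_op D A c (e p)))\<^sup>2) \<le> q p / (1 + c * lam p)"
        using q_nonneg[of p] by (simp add: resolvent_basis[OF assms] power_divide)
    qed
  qed
  from AE_summable_operator_noise[OF this, of k] show ?thesis
    by (simp add: resolvent_basis[OF assms])
qed

section \<open>One step of a damped scheme\<close>

text \<open>
  The bound that the iterates of a scheme inherit from step to step, and that invariant
  distributions satisfy.
\<close>

definition smooth_moments :: "'n measure \<Rightarrow> ('n \<Rightarrow> 'a) \<Rightarrow> bool" where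
  "smooth_moments N U \<longleftrightarrow> U \<in> borel_measurable N \<and>
     (\<exists>C\<ge>0. \<forall>p. (\<integral>\<^sup>+z. ennreal ((U z \<bullet> e p)\<^sup>2) \<partial>N) \<le> ennreal (C * (q p * lam p powr (-2))))"

lemma smooth_moments_cong_distr:
  assumes "U \<in> borel_measurable N" "U' \<in> borel_measurable N'" "distr N borel U = distr N' borel U'"
  shows "smooth_moments N U \<longleftrightarrow> smooth_moments N' U'"
proof -
  have "(\<integral>\<^sup>+z. ennreal ((U z \<bullet> e p)\<^sup>2) \<partial>N) = (\<integral>\<^sup>+u. ennreal ((u \<bullet> e p)\<^sup>2) \<partial>distr N borel U)" for p
    using assms(1) by (subst nn_integral_distr) auto
  moreover have "(\<integral>\<^sup>+z. ennreal ((U' z \<bullet> e p)\<^sup>2) \<partial>N') = (\<integral>\<^sup>+u. ennreal ((u \<bullet> e p)\<^sup>2) \<partial>distr N' borel U')" for p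
    using assms(2) by (subst nn_integral_distr) auto
  ultimately show ?thesis
    using assms by (simp add: smooth_moments_def)
qed

text \<open>
  A random element \<open>Z\<close> with law \<open>M\<close> carries a copy of the noise. This covers both the iterates, with
  \<open>Z\<close> the identity, and the invariant distributions, with \<open>Z\<close> the projection of the product of state
  space and noise space to the latter.
\<close>

lemma second_moment_xi_copy:
  assumes [measurable]: "Z \<in> measurable N M" and "distr N M Z = M"
  shows "(\<integral>\<^sup>+z. ennreal ((\<xi> k (Z z) p)\<^sup>2) \<partial>N) = ennreal (q p)"
proof -
  have "(\<integral>\<^sup>+z. ennreal ((\<xi> k (Z z) p)\<^sup>2) \<partial>N) = (\<integral>\<^sup>+\<omega>. ennreal ((\<xi> k \<omega> p)\<^sup>2) \<partial>distr N M Z)"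
    by (subst nn_integral_distr) auto
  then show ?thesis
    by (simp add: assms(2) second_moment_xi)
qed

lemma AE_copy:
  assumes "Z \<in> measurable N M" "distr N M Z = M" "AE \<omega> in M. P \<omega>"
  shows "AE z in N. P (Z z)"
  by (rule AE_distrD[OF assms(1)]) (subst assms(2), rule assms(3))

end

text \<open>
  Both schemes act on the coefficients of the state as \<open>x \<mapsto> x / (1 + h * lam p) + g p * \<xi>\<close> with
  \<open>g p\<close> of the exact order \<open>1 / lam p\<close>. The exceptional null set is the same for all states, so it
  does not matter how the state is distributed.
\<close>

locale damped_step = noise_input e D A lam Q q M \<xi> h
  for e :: "nat \<Rightarrow> 'a::{real_inner, banach, second_countable_topology}"
    and D :: "'a set" and A :: "'a \<Rightarrow> 'a" and lam :: "nat \<Rightarrow> real"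
    and Q :: "'a \<Rightarrow> 'a" and q :: "nat \<Rightarrow> real" and M :: "'w measure"
    and \<xi> :: "nat \<Rightarrow> 'w \<Rightarrow> nat \<Rightarrow> real" and h :: real +
  fixes step :: "'a \<Rightarrow> (nat \<Rightarrow> real) \<Rightarrow> 'a" and g :: "nat \<Rightarrow> real" and \<kappa>1 \<kappa>2 :: real
  assumes step_measurable:
      "\<And>k. (\<lambda>z. step (fst z) (\<xi> k (snd z))) \<in> borel_measurable (borel \<Otimes>\<^sub>M M)"
    and step_component:
      "\<And>k. AE \<omega> in M. \<forall>v p. step v (\<xi> k \<omega>) \<bullet> e p = (v \<bullet> e p) / (1 + h * lam p) + g p * \<xi> k \<omega> p"
    and gain_pos: "0 < \<kappa>1" and gain_lower: "\<And>p. \<kappa>1 / lam p \<le> g p"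
    and gain_upper: "\<And>p. g p \<le> \<kappa>2 / lam p"
begin

lemma damping_pos: "0 < 1 / (1 + h * lam p)" and damping_less_1: "1 / (1 + h * lam p) < 1"
  and damping_le: "1 / (1 + h * lam p) \<le> 1 / h * (1 / lam p)"
proof -
  have "0 < h * lam p"
    using h_pos by simp
  then show "0 < 1 / (1 + h * lam p)" "1 / (1 + h * lam p) < 1"
    "1 / (1 + h * lam p) \<le> 1 / h * (1 / lam p)"
    by (auto simp: add_pos_pos intro!: divide_left_mono mult_pos_pos)
qed

lemma gain_nonneg: "0 \<le> g p"
  using gain_lower[of p] gain_pos eigenvalue_pos[of p] by (meson divide_pos_pos less_le_trans less_imp_le)

lemma powr_minus_2: "lam p powr (-2) = (1 / lam p)\<^sup>2"
proof -
  have "lam p powr 2 = (lam p)\<^sup>2"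
    by (rule powr_numeral) (simp add: less_imp_le)
  then show ?thesis
    by (simp add: powr_minus_divide power_one_over)
qed

lemma gain_square_lower: "\<kappa>1\<^sup>2 * lam p powr (-2) \<le> (g p)\<^sup>2"
  using power_mono[OF gain_lower[of p], of 2] gain_pos
  by (simp add: powr_minus_2 power_divide less_imp_le)

lemma gain_square_upper: "(g p)\<^sup>2 \<le> \<kappa>2\<^sup>2 * lam p powr (-2)"
  using power_mono[OF gain_upper[of p] gain_nonneg, of 2]
  by (simp add: powr_minus_2 power_divide)

lemma damping_square_upper: "(1 / (1 + h * lam p))\<^sup>2 \<le> (1 / h)\<^sup>2 * lam p powr (-2)"
  unfolding powr_minus_2 power_mult_distrib[symmetric]
  using damping_pos[of p] by (intro power_mono damping_le) simp

lemma step_output_measurable [measurable (raw)]: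
  assumes "U \<in> borel_measurable N" "Z \<in> measurable N M"
  shows "(\<lambda>z. step (U z) (\<xi> k (Z z))) \<in> borel_measurable N"
  using measurable_compose[OF measurable_Pair[OF assms] step_measurable[of k]] by simp

text \<open>
  The damped state is smoother than the fresh noise by two powers of \<open>lam\<close>. Hence the triangle
  inequality alone shows that the regularity of the new state is that of the fresh noise, whatever
  the joint law of state and noise.
\<close>

lemma step_smooth_and_reg:
  assumes U: "smooth_moments N U" and Z [measurable]: "Z \<in> measurable N M" and copy: "distr N M Z = M"
  shows "smooth_moments N (\<lambda>z. step (U z) (\<xi> k (Z z)))"
    and "reg e lam (distr N borel (\<lambda>z. step (U z) (\<xi> k (Z z)))) = s_bar e lam Q + 1"
proof -
  define W where "W = (\<lambda>z. step (U z) (\<xi> k (Z z)))"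
  define r where "r = (\<lambda>p. 1 / (1 + h * lam p))"
  have U_meas [measurable]: "U \<in> borel_measurable N"
    using U by (simp add: smooth_moments_def)
  obtain C where C: "0 \<le> C"
    "\<And>p. (\<integral>\<^sup>+z. ennreal ((U z \<bullet> e p)\<^sup>2) \<partial>N) \<le> ennreal (C * (q p * lam p powr (-2)))"
    using U by (auto simp: smooth_moments_def)
  have W_meas [measurable]: "W \<in> borel_measurable N"
    unfolding W_def by measurable
  have comp: "AE z in N. \<forall>p. W z \<bullet> e p = r p * (U z \<bullet> e p) + g p * \<xi> k (Z z) p"
    using AE_copy[OF Z copy step_component[of k]] by eventually_elim (simp add: W_def r_def)
  have scaled: "(\<integral>\<^sup>+z. ennreal ((c * f z)\<^sup>2) \<partial>N) = ennreal (c\<^sup>2) * (\<integral>\<^sup>+z. ennreal ((f z)\<^sup>2) \<partial>N)"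
    if [measurable]: "f \<in> borel_measurable N" for c :: real and f
    by (simp add: power_mult_distrib ennreal_mult nn_integral_cmult)
  have sum_le: "(\<integral>\<^sup>+z. ennreal ((f z + f' z)\<^sup>2) \<partial>N)
      \<le> 2 * (\<integral>\<^sup>+z. ennreal ((f z)\<^sup>2) \<partial>N) + 2 * (\<integral>\<^sup>+z. ennreal ((f' z)\<^sup>2) \<partial>N)"
    if [measurable]: "f \<in> borel_measurable N" "f' \<in> borel_measurable N" for f f' :: "_ \<Rightarrow> real"
  proof -
    have "(\<integral>\<^sup>+z. ennreal ((f z + f' z)\<^sup>2) \<partial>N)
        \<le> (\<integral>\<^sup>+z. 2 * ennreal ((f z)\<^sup>2) + 2 * ennreal ((f' z)\<^sup>2) \<partial>N)"
      by (intro nn_integral_mono ennreal_square_add_le)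
    then show ?thesis
      by (simp add: nn_integral_add nn_integral_cmult)
  qed
  let ?w = "\<lambda>p. q p * lam p powr (-2)"
  let ?m = "\<lambda>p. \<integral>\<^sup>+z. ennreal ((W z \<bullet> e p)\<^sup>2) \<partial>N"
  have w_nonneg: "0 \<le> ?w p" for p
    using q_nonneg by simp
  have damped_U: "(\<integral>\<^sup>+z. ennreal ((r p * (U z \<bullet> e p))\<^sup>2) \<partial>N) \<le> ennreal ((r p)\<^sup>2 * (C * ?w p))" for p
    using mult_left_mono[OF C(2)[of p], of "ennreal ((r p)\<^sup>2)"] C(1) w_nonneg[of p]
    by (subst scaled) (auto simp: ennreal_mult[symmetric])
  have fresh: "(\<integral>\<^sup>+z. ennreal ((g p * \<xi> k (Z z) p)\<^sup>2) \<partial>N) = ennreal ((g p)\<^sup>2 * q p)" for p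
    by (subst scaled) (auto simp: second_moment_xi_copy[OF Z copy] ennreal_mult[symmetric] q_nonneg)
  have upper: "?m p \<le> ennreal ((2 * C + 2 * \<kappa>2\<^sup>2) * ?w p)" for p
  proof -
    have "?m p = (\<integral>\<^sup>+z. ennreal ((r p * (U z \<bullet> e p) + g p * \<xi> k (Z z) p)\<^sup>2) \<partial>N)"
      by (rule nn_integral_cong_AE) (use comp in eventually_elim, simp)
    also have "\<dots> \<le> 2 * ennreal ((r p)\<^sup>2 * (C * ?w p)) + 2 * ennreal ((g p)\<^sup>2 * q p)"
      by (rule order_trans[OF sum_le]) (auto intro!: add_mono mult_left_mono damped_U simp: fresh)
    also have "\<dots> = ennreal (2 * ((r p)\<^sup>2 * (C * ?w p)) + 2 * ((g p)\<^sup>2 * q p))"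
      using C(1) w_nonneg[of p] q_nonneg[of p] by (simp add: ennreal_plus ennreal_mult)
    also have "\<dots> \<le> ennreal ((2 * C + 2 * \<kappa>2\<^sup>2) * ?w p)"
    proof (rule ennreal_leI)
      have "(r p)\<^sup>2 * (C * ?w p) \<le> 1 * (C * ?w p)"
        using C(1) w_nonneg[of p] damping_pos[of p] damping_less_1[of p]
        by (intro mult_right_mono) (auto simp: r_def power_le_one simp del: power_divide)
      moreover have "(g p)\<^sup>2 * q p \<le> \<kappa>2\<^sup>2 * lam p powr (-2) * q p"
        by (intro mult_right_mono gain_square_upper q_nonneg)
      ultimately show "2 * ((r p)\<^sup>2 * (C * ?w p)) + 2 * ((g p)\<^sup>2 * q p) \<le> (2 * C + 2 * \<kappa>2\<^sup>2) * ?w p"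
        by (simp add: algebra_simps)
    qed
    finally show ?thesis .
  qed
  show "smooth_moments N (\<lambda>z. step (U z) (\<xi> k (Z z)))"
    unfolding smooth_moments_def W_def[symmetric] using upper C(1) W_meas
    by (intro conjI exI[of _ "2 * C + 2 * \<kappa>2\<^sup>2"]) auto
  \<comment> \<open>The damped state is the error of smaller order in \<open>reg_eqI\<close> with \<open>t = 2\<close> and \<open>\<delta> = 2\<close>. The
    constant \<open>K\<close> comes from writing the fresh noise as the new state minus the damped old one.\<close>
  define K where "K = (2 + 2 * (C / h\<^sup>2)) / \<kappa>1\<^sup>2"
  have lower: "ennreal (?w p) \<le> ennreal K * (?m p + ennreal (q p * lam p powr (-2 - 2)))" for p
  proof -
    have "ennreal ((g p)\<^sup>2 * q p) = (\<integral>\<^sup>+z. ennreal ((W z \<bullet> e p + - (r p * (U z \<bullet> e p)))\<^sup>2) \<partial>N)"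
      unfolding fresh[symmetric] by (rule nn_integral_cong_AE) (use comp in eventually_elim, simp)
    also have "\<dots> \<le> 2 * ?m p + 2 * ennreal ((r p)\<^sup>2 * (C * ?w p))"
      by (rule order_trans[OF sum_le]) (auto intro!: add_mono mult_left_mono damped_U)
    also have "\<dots> \<le> 2 * ?m p + 2 * ennreal ((C / h\<^sup>2) * (q p * lam p powr (-2 - 2)))"
    proof (intro add_left_mono mult_left_mono ennreal_leI)
      have "(r p)\<^sup>2 * (C * ?w p) \<le> (1 / h)\<^sup>2 * lam p powr (-2) * (C * ?w p)"
        unfolding r_def using C(1) w_nonneg[of p] by (intro mult_right_mono damping_square_upper) auto
      also have "\<dots> = (C / h\<^sup>2) * (q p * (lam p powr (-2) * lam p powr (-2)))"
        by (simp add: power_divide)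
      finally show "(r p)\<^sup>2 * (C * ?w p) \<le> (C / h\<^sup>2) * (q p * lam p powr (-2 - 2))"
        by (simp add: powr_add[symmetric])
    qed simp
    also have "\<dots> \<le> ennreal (2 + 2 * (C / h\<^sup>2)) * (?m p + ennreal (q p * lam p powr (-2 - 2)))"
    proof -
      have "2 * ?m p \<le> ennreal (2 + 2 * (C / h\<^sup>2)) * ?m p"
        using C(1) by (intro mult_right_mono) (auto simp: ennreal_plus)
      moreover have "2 * ennreal ((C / h\<^sup>2) * (q p * lam p powr (-2 - 2)))
          \<le> ennreal (2 + 2 * (C / h\<^sup>2)) * ennreal (q p * lam p powr (-2 - 2))"
      proof -
        have "2 * ennreal (a * b) = ennreal (2 * a) * ennreal b" if "0 \<le> a" "0 \<le> b" for a b
          using that by (simp add: ennreal_mult mult.assoc)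
        then have "2 * ennreal ((C / h\<^sup>2) * (q p * lam p powr (-2 - 2)))
            = ennreal (2 * (C / h\<^sup>2)) * ennreal (q p * lam p powr (-2 - 2))"
          using C(1) q_nonneg[of p] by (metis divide_nonneg_nonneg mult_nonneg_nonneg powr_ge_zero zero_le_power2)
        also have "\<dots> \<le> ennreal (2 + 2 * (C / h\<^sup>2)) * ennreal (q p * lam p powr (-2 - 2))"
          by (intro mult_right_mono ennreal_leI) auto
        finally show ?thesis .
      qed
      ultimately show ?thesis
        unfolding distrib_left by (rule add_mono)
    qed
    finally have bound: "ennreal ((g p)\<^sup>2 * q p)
        \<le> ennreal (2 + 2 * (C / h\<^sup>2)) * (?m p + ennreal (q p * lam p powr (-2 - 2)))" .
    have "\<kappa>1\<^sup>2 * ?w p \<le> (g p)\<^sup>2 * q p"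
      using mult_right_mono[OF gain_square_lower q_nonneg] by (simp add: mult_ac)
    then have "?w p \<le> 1 / \<kappa>1\<^sup>2 * ((g p)\<^sup>2 * q p)"
      using gain_pos by (simp add: field_simps)
    then have "ennreal (?w p) \<le> ennreal (1 / \<kappa>1\<^sup>2) * ennreal ((g p)\<^sup>2 * q p)"
      using q_nonneg[of p] by (subst ennreal_mult[symmetric]) (auto intro: ennreal_leI)
    also have "\<dots> \<le> ennreal (1 / \<kappa>1\<^sup>2) * (ennreal (2 + 2 * (C / h\<^sup>2))
        * (?m p + ennreal (q p * lam p powr (-2 - 2))))"
      by (intro mult_left_mono bound) simp
    also have "\<dots> = ennreal K * (?m p + ennreal (q p * lam p powr (-2 - 2)))"
    proof -
      have "ennreal (1 / \<kappa>1\<^sup>2) * ennreal (2 + 2 * (C / h\<^sup>2)) = ennreal K"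
        using C(1) by (subst ennreal_mult[symmetric]) (auto simp: K_def)
      then show ?thesis
        by (simp only: mult.assoc[symmetric])
    qed
    finally show ?thesis .
  qed
  have m_eq: "(\<integral>\<^sup>+u. ennreal ((u \<bullet> e p)\<^sup>2) \<partial>distr N borel W) = ?m p" for p
    by (subst nn_integral_distr) auto
  define C' where "C' = (2 * C + 2 * \<kappa>2\<^sup>2) + K"
  have K: "0 \<le> K" "0 \<le> 2 * C + 2 * \<kappa>2\<^sup>2"
    using C(1) by (auto simp: K_def)
  have "reg e lam (distr N borel W) = s_bar e lam Q + ereal (2 - 1)"
  proof (rule reg_eqI[where \<delta>=2 and C=C'])
    show "0 \<le> C'"
      using K by (simp add: C'_def)
    show "(\<integral>\<^sup>+u. ennreal ((u \<bullet> e p)\<^sup>2) \<partial>distr N borel W) \<le> ennreal (C' * (q p * lam p powr (- 2)))" for p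
      unfolding m_eq using K w_nonneg[of p]
      by (intro order_trans[OF upper] ennreal_leI mult_right_mono) (auto simp: C'_def)
    show "ennreal (q p * lam p powr (- 2)) \<le> ennreal C' *
        ((\<integral>\<^sup>+u. ennreal ((u \<bullet> e p)\<^sup>2) \<partial>distr N borel W) + ennreal (q p * lam p powr (- 2 - 2)))" for p
      unfolding m_eq using K
      by (intro order_trans[OF lower] mult_right_mono ennreal_leI) (auto simp: C'_def)
  qed auto
  then show "reg e lam (distr N borel (\<lambda>z. step (U z) (\<xi> k (Z z)))) = s_bar e lam Q + 1"
    by (simp add: W_def one_ereal_def)
qed

lemma chain_smooth:
  assumes w_0: "\<And>\<omega>. w 0 \<omega> = 0" and w_Suc: "\<And>k \<omega>. w (Suc k) \<omega> = step (w k \<omega>) (\<xi> k \<omega>)"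
  shows "smooth_moments M (w k)"
proof (induction k)
  case 0
  have "w 0 = (\<lambda>_. 0)"
    using w_0 by auto
  then show ?case
    by (auto simp: smooth_moments_def)
next
  case (Suc k)
  have "w (Suc k) = (\<lambda>\<omega>. step (w k \<omega>) (\<xi> k \<omega>))"
    using w_Suc by auto
  then show ?case
    using step_smooth_and_reg(1)[OF Suc, of "\<lambda>\<omega>. \<omega>" k] by simp
qed

lemma chain_reg:
  assumes w_0: "\<And>\<omega>. w 0 \<omega> = 0" and w_Suc: "\<And>k \<omega>. w (Suc k) \<omega> = step (w k \<omega>) (\<xi> k \<omega>)"
    and "1 \<le> n"
  shows "reg e lam (distr M borel (w n)) = s_bar e lam Q + 1"
proof -
  obtain k where k: "n = Suc k"
    using \<open>1 \<le> n\<close> by (cases n) auto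
  have "w n = (\<lambda>\<omega>. step (w k \<omega>) (\<xi> k \<omega>))"
    using w_Suc k by auto
  then show ?thesis
    using step_smooth_and_reg(2)[OF chain_smooth[OF w_0 w_Suc, of k], of "\<lambda>\<omega>. \<omega>" k] by simp
qed

text \<open>
  In the product of the invariant distribution and the noise space, the coefficients of the state
  are stationary for a scalar recursion with damping at most \<open>1 / (1 + h * lam 0) < 1\<close>.
\<close>

lemma invariant_smooth_and_reg:
  assumes "invariant_distribution (\<lambda>v. distr M borel (\<lambda>\<omega>. step v (\<xi> 0 \<omega>))) \<nu>"
  shows "smooth_moments \<nu> (\<lambda>v. v)" and "reg e lam \<nu> = s_bar e lam Q + 1"
proof -
  interpret \<nu>: prob_space \<nu>
    using assms by (simp add: invariant_distribution_def)
  have sets_\<nu>: "sets \<nu> = sets borel"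
    using assms by (simp add: invariant_distribution_def)
  let ?N = "\<nu> \<Otimes>\<^sub>M M"
  interpret N: pair_prob_space \<nu> M ..
  have sets_N: "sets ?N = sets (borel \<Otimes>\<^sub>M M)"
    by (intro sets_pair_measure_cong sets_\<nu> refl)
  have id_meas [measurable]: "(\<lambda>v. v) \<in> borel_measurable \<nu>"
    by (simp add: measurable_cong_sets[OF sets_\<nu> refl])
  have fst_meas [measurable]: "fst \<in> borel_measurable ?N"
    using measurable_compose[OF measurable_fst id_meas] by simp
  define W where "W = (\<lambda>z. step (fst z) (\<xi> 0 (snd z)))"
  have W_meas [measurable]: "W \<in> borel_measurable ?N"
    unfolding W_def by measurable
  have stationary: "\<nu> = distr ?N borel W"
  proof -
    have "\<nu> = \<nu> \<bind> (\<lambda>v. distr M borel (\<lambda>\<omega>. step v (\<xi> 0 \<omega>)))"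
      using assms by (simp add: invariant_distribution_def)
    also have "\<dots> = distr ?N borel (case_prod (\<lambda>v \<omega>. step v (\<xi> 0 \<omega>)))"
      using W_meas by (intro bind_distr_eq_distr_pair \<nu>.prob_space_axioms)
        (simp add: W_def case_prod_beta')
    finally show ?thesis
      by (simp add: W_def case_prod_beta')
  qed
  have fst_law: "distr ?N borel fst = \<nu>"
  proof -
    have "distr ?N borel fst = distr ?N \<nu> fst"
      by (rule distr_cong) (simp_all add: sets_\<nu>)
    then show ?thesis
      by (simp add: distr_pair_fst)
  qed
  have copy: "distr ?N M snd = M"
    by (rule distr_pair_snd_prob[OF \<nu>.prob_space_axioms])
  define d where "d = 1 - 1 / (1 + h * lam 0)"
  have d: "0 < d"
    using damping_less_1[of 0] by (simp add: d_def)
  have moment: "(\<integral>\<^sup>+v. ennreal ((v \<bullet> e p)\<^sup>2) \<partial>\<nu>) \<le> ennreal ((\<kappa>2\<^sup>2 / d\<^sup>2) * (q p * lam p powr (-2)))" for p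
  proof -
    let ?r = "1 / (1 + h * lam p)"
    have "distr ?N borel (\<lambda>z. fst z \<bullet> e p) = distr (distr ?N borel fst) borel (\<lambda>v. v \<bullet> e p)"
      by (subst distr_distr) (auto simp: comp_def)
    also have "\<dots> = distr (distr ?N borel W) borel (\<lambda>v. v \<bullet> e p)"
      using fst_law stationary by simp
    also have "\<dots> = distr ?N borel (\<lambda>z. W z \<bullet> e p)"
      by (subst distr_distr) (auto simp: comp_def)
    also have "\<dots> = distr ?N borel (\<lambda>z. ?r * (fst z \<bullet> e p) + g p * \<xi> 0 (snd z) p)"
    proof (rule distr_cong_AE)
      show "AE z in ?N. W z \<bullet> e p = ?r * (fst z \<bullet> e p) + g p * \<xi> 0 (snd z) p"
        using AE_copy[OF measurable_snd copy step_component[of 0]]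
        by eventually_elim (simp add: W_def)
    qed auto
    finally have law: "distr ?N borel (\<lambda>z. fst z \<bullet> e p)
        = distr ?N borel (\<lambda>z. ?r * (fst z \<bullet> e p) + g p * \<xi> 0 (snd z) p)" .
    have noise: "(\<integral>\<^sup>+z. ennreal ((g p * \<xi> 0 (snd z) p)\<^sup>2) \<partial>?N) \<le> ennreal ((g p)\<^sup>2 * q p)"
      using second_moment_xi_copy[OF measurable_snd copy, of 0 p] q_nonneg[of p]
      by (simp add: power_mult_distrib ennreal_mult nn_integral_cmult)
    have "(\<integral>\<^sup>+v. ennreal ((v \<bullet> e p)\<^sup>2) \<partial>\<nu>) = (\<integral>\<^sup>+z. ennreal ((fst z \<bullet> e p)\<^sup>2) \<partial>?N)"
      by (subst fst_law[symmetric], subst nn_integral_distr) auto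
    also have "\<dots> \<le> ennreal ((g p)\<^sup>2 * q p / (1 - ?r)\<^sup>2)"
      by (rule stationary_second_moment[OF N.prob_space_axioms _ _ damping_pos damping_less_1 _ noise law])
         (use q_nonneg in auto)
    also have "\<dots> \<le> ennreal ((\<kappa>2\<^sup>2 / d\<^sup>2) * (q p * lam p powr (-2)))"
    proof (rule ennreal_leI)
      have "?r \<le> 1 / (1 + h * lam 0)"
        using h_pos eigenvalue_ge_first[of p] eigenvalue_0_pos
        by (intro divide_left_mono) (auto intro!: mult_pos_pos add_pos_pos)
      then have "d\<^sup>2 \<le> (1 - ?r)\<^sup>2"
        using d by (intro power_mono) (auto simp: d_def)
      moreover have "(g p)\<^sup>2 * q p \<le> \<kappa>2\<^sup>2 * lam p powr (-2) * q p"
        by (intro mult_right_mono gain_square_upper q_nonneg)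
      ultimately have "(g p)\<^sup>2 * q p / (1 - ?r)\<^sup>2 \<le> \<kappa>2\<^sup>2 * lam p powr (-2) * q p / d\<^sup>2"
        using d q_nonneg[of p] by (intro frac_le) auto
      then show "(g p)\<^sup>2 * q p / (1 - ?r)\<^sup>2 \<le> (\<kappa>2\<^sup>2 / d\<^sup>2) * (q p * lam p powr (-2))"
        by (simp add: mult_ac)
    qed
    finally show ?thesis .
  qed
  show smooth: "smooth_moments \<nu> (\<lambda>v. v)"
    unfolding smooth_moments_def using moment
    by (intro conjI exI[of _ "\<kappa>2\<^sup>2 / d\<^sup>2"]) auto
  have "distr \<nu> borel (\<lambda>v. v) = \<nu>"
    using sets_\<nu> distr_id2[of borel \<nu>] by (simp add: id_def)
  then have "smooth_moments ?N fst"
    using smooth smooth_moments_cong_distr[OF id_meas fst_meas] fst_law by simp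
  then show "reg e lam \<nu> = s_bar e lam Q + 1"
    using step_smooth_and_reg(2)[of ?N fst snd 0] copy stationary by (simp add: W_def)
qed

end

section \<open>The two schemes are damped steps\<close>

context noise_input
begin

lemma resolvent_factor_lower:
  assumes "0 < c"
  shows "(1 / (1 / lam 0 + c)) / lam p \<le> 1 / (1 + c * lam p)"
proof -
  have "1 \<le> lam p / lam 0"
    using eigenvalue_ge_first[of p] eigenvalue_0_pos by simp
  then have "1 + c * lam p \<le> (1 / lam 0 + c) * lam p"
    by (simp add: distrib_right)
  moreover have "0 < 1 + c * lam p"
    using assms by (simp add: add_pos_pos)
  ultimately have "1 / ((1 / lam 0 + c) * lam p) \<le> 1 / (1 + c * lam p)"
    by (intro divide_left_mono) (auto intro: mult_pos_pos)
  then show ?thesis by simp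
qed

lemma resolvent_factor_upper:
  assumes "0 < c"
  shows "1 / (1 + c * lam p) \<le> (1 / c) / lam p"
proof -
  have "0 < c * lam p"
    using assms by simp
  then have "1 / (1 + c * lam p) \<le> 1 / (c * lam p)"
    by (intro divide_left_mono) (auto intro: mult_pos_pos)
  then show ?thesis by simp
qed

lemma damped_step_euler:
  "damped_step e D A lam Q q M \<xi> h (euler_step e (resolvent_op D A h) h)
     (\<lambda>p. sqrt h / (1 + h * lam p)) (sqrt h * (1 / (1 / lam 0 + h))) (sqrt h * (1 / h))"
proof
  show "(\<lambda>z. euler_step e (resolvent_op D A h) h (fst z) (\<xi> k (snd z)))
      \<in> borel_measurable (borel \<Otimes>\<^sub>M M)" for k
    unfolding euler_step_def apply_op_def by measurable
  show "AE \<omega> in M. \<forall>v p. euler_step e (resolvent_op D A h) h v (\<xi> k \<omega>) \<bullet> e p =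
      (v \<bullet> e p) / (1 + h * lam p) + sqrt h / (1 + h * lam p) * \<xi> k \<omega> p" for k
    using AE_summable_resolvent_noise[OF h_pos, of k]
  proof eventually_elim
    case (elim \<omega>)
    show ?case
    proof (intro allI)
      fix v p
      let ?a = "\<lambda>p. (v \<bullet> e p) / (1 + h * lam p)"
      let ?b = "\<lambda>p. \<xi> k \<omega> p / (1 + h * lam p)"
      have "summable (\<lambda>p. ?a p *\<^sub>R e p + sqrt h *\<^sub>R (?b p *\<^sub>R e p))"
        by (intro summable_add summable_scaleR_right elim sums_summable[OF resolvent_expansion] h_pos)
      then have summ: "summable (\<lambda>p. (?a p + sqrt h * ?b p) *\<^sub>R e p)"
        by (simp add: scaleR_add_left)
      have "euler_step e (resolvent_op D A h) h v (\<xi> k \<omega>) = (\<Sum>p. (?a p + sqrt h * ?b p) *\<^sub>R e p)"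
        unfolding euler_step_def apply_op_def
        by (simp add: resolvent_basis[OF h_pos] add_divide_distrib)
      then show "euler_step e (resolvent_op D A h) h v (\<xi> k \<omega>) \<bullet> e p =
          (v \<bullet> e p) / (1 + h * lam p) + sqrt h / (1 + h * lam p) * \<xi> k \<omega> p"
        using inner_suminf_basis[OF summ, of p] by simp
    qed
  qed
  show "0 < sqrt h * (1 / (1 / lam 0 + h))"
    using h_pos by (simp add: add_pos_pos)
  show "sqrt h * (1 / (1 / lam 0 + h)) / lam p \<le> sqrt h / (1 + h * lam p)" for p
    using mult_left_mono[OF resolvent_factor_lower[OF h_pos, of p], of "sqrt h"] h_pos by simp
  show "sqrt h / (1 + h * lam p) \<le> sqrt h * (1 / h) / lam p" for p
    using mult_left_mono[OF resolvent_factor_upper[OF h_pos, of p], of "sqrt h"] h_pos by simp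
qed

text \<open>
  The part of the noise that enters after \<open>J1\<close> carries the coefficient \<open>b > 0\<close>, and the part that
  enters before it only adds to this. So the gain lies between \<open>b\<close> and \<open>a + b\<close> times
  \<open>sqrt h / (1 + b * h * lam p)\<close>.
\<close>

lemma damped_step_integrator:
  fixes a b :: real
  defines "a \<equiv> (sqrt 2 - 1) / 2" and "b \<equiv> (3 - sqrt 2) / 2"
  shows "damped_step e D A lam Q q M \<xi> h
     (integrator_step e (resolvent_op D A h) (resolvent_op D A (b * h)) h)
     (\<lambda>p. sqrt h * (a / (1 + h * lam p) + b) / (1 + b * h * lam p))
     (sqrt h * b * (1 / (1 / lam 0 + b * h))) (sqrt h * (a + b) * (1 / (b * h)))"
proof
  have "1 < sqrt 2" "sqrt 2 < 3"
    by (auto intro: real_less_rsqrt real_less_lsqrt)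
  then have ab: "0 < a" "0 < b"
    by (auto simp: a_def b_def)
  then have bh: "0 < b * h"
    using h_pos by simp
  let ?J1 = "resolvent_op D A h" and ?J2 = "resolvent_op D A (b * h)"
  have [measurable]: "?J1 \<in> borel_measurable borel"
    by (rule resolvent_measurable[OF h_pos])
  show "(\<lambda>z. integrator_step e ?J1 ?J2 h (fst z) (\<xi> k (snd z))) \<in> borel_measurable (borel \<Otimes>\<^sub>M M)" for k
    unfolding integrator_step_def apply_op_def by measurable
  show "AE \<omega> in M. \<forall>v p. integrator_step e ?J1 ?J2 h v (\<xi> k \<omega>) \<bullet> e p = (v \<bullet> e p) / (1 + h * lam p)
      + sqrt h * (a / (1 + h * lam p) + b) / (1 + b * h * lam p) * \<xi> k \<omega> p" for k
    using AE_summable_resolvent_noise[OF bh, of k]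
  proof eventually_elim
    case (elim \<omega>)
    have J2: "apply_op e ?J2 (\<xi> k \<omega>) \<bullet> e p = \<xi> k \<omega> p / (1 + b * h * lam p)" for p
      unfolding apply_op_def using inner_suminf_basis[OF elim]
      by (simp add: resolvent_basis[OF bh])
    have step_eq: "integrator_step e ?J1 ?J2 h v x =
        ?J1 (v + (a * sqrt h) *\<^sub>R apply_op e ?J2 x) + (b * sqrt h) *\<^sub>R apply_op e ?J2 x" for v x
      by (simp add: integrator_step_def a_def b_def)
    show ?case
      unfolding step_eq
      by (simp add: inner_add_left resolvent_component[OF h_pos] J2 add_divide_distrib algebra_simps)
  qed
  have factor: "b \<le> a / (1 + h * lam p) + b" "a / (1 + h * lam p) + b \<le> a + b" for p
  proof -
    have "0 < h * lam p"
      using h_pos by simp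
    then have "0 \<le> a / (1 + h * lam p)" "a / (1 + h * lam p) \<le> a"
      using ab by (auto simp: divide_le_eq)
    then show "b \<le> a / (1 + h * lam p) + b" "a / (1 + h * lam p) + b \<le> a + b"
      by auto
  qed
  show "0 < sqrt h * b * (1 / (1 / lam 0 + b * h))"
    using h_pos ab bh by (simp add: add_pos_pos)
  show "sqrt h * b * (1 / (1 / lam 0 + b * h)) / lam p
      \<le> sqrt h * (a / (1 + h * lam p) + b) / (1 + b * h * lam p)" for p
  proof -
    have "0 \<le> (1 / (1 / lam 0 + b * h)) / lam p"
      using bh eigenvalue_0_pos
      by (intro divide_nonneg_nonneg add_nonneg_nonneg) (auto simp: less_imp_le)
    moreover have "0 \<le> sqrt h * (a / (1 + h * lam p) + b)"
      using h_pos ab factor(1)[of p] by (intro mult_nonneg_nonneg) auto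
    ultimately have "sqrt h * b * ((1 / (1 / lam 0 + b * h)) / lam p)
        \<le> sqrt h * (a / (1 + h * lam p) + b) * (1 / (1 + b * h * lam p))"
      using h_pos bh
      by (intro mult_mono mult_left_mono factor(1) resolvent_factor_lower) auto
    then show ?thesis by simp
  qed
  show "sqrt h * (a / (1 + h * lam p) + b) / (1 + b * h * lam p)
      \<le> sqrt h * (a + b) * (1 / (b * h)) / lam p" for p
  proof -
    have "0 < b * h * lam p"
      using bh by simp
    then have "0 \<le> 1 / (1 + b * h * lam p)"
      by simp
    moreover have "0 \<le> sqrt h * (a + b)"
      using h_pos ab by simp
    ultimately have "sqrt h * (a / (1 + h * lam p) + b) * (1 / (1 + b * h * lam p))
        \<le> sqrt h * (a + b) * ((1 / (b * h)) / lam p)"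
      using h_pos bh
      by (intro mult_mono mult_left_mono factor(2) resolvent_factor_upper) auto
    then show ?thesis by simp
  qed
qed

section \<open>The postprocessor\<close>

text \<open>
  Both sides are the \<open>i\<close>-th diagonal entry of the covariance \<open>J3 Q J3\<^sup>T\<close>: the left one results from
  expanding \<open>J3\<^sup>T (e i)\<close> in the eigenbasis of \<open>Q\<close>.
\<close>

lemma covariance_sums:
  assumes J3: "bounded_linear J3"
    and J3_eq: "J3 \<circ> Q \<circ> adjoint J3 = resolvent_op D A (h / 2) \<circ> Q"
  shows "(\<lambda>p. q p * (J3 (e p) \<bullet> e i)\<^sup>2) sums (q i / (1 + h / 2 * lam i))"
proof -
  have h2: "0 < h / 2"
    using h_pos by simp
  interpret J3: bounded_linear J3 by fact
  interpret Q: bounded_linear Q by (rule Q_bounded)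
  define y where "y = adjoint J3 (e i)"
  have y: "y \<bullet> e p = J3 (e p) \<bullet> e i" for p
    using adjoint_works_hilbert[OF J3, of "e p" "e i"] by (simp add: y_def inner_commute)
  have "(\<lambda>p. J3 (Q ((y \<bullet> e p) *\<^sub>R e p)) \<bullet> e i) sums (J3 (Q y) \<bullet> e i)"
    by (intro bounded_linear.sums[OF bounded_linear_inner_left] J3.sums Q.sums basis_expansion_sums)
  moreover have "J3 (Q ((y \<bullet> e p) *\<^sub>R e p)) \<bullet> e i = q p * (J3 (e p) \<bullet> e i)\<^sup>2" for p
    by (simp add: Q.scaleR J3.scaleR Q_eigen y power2_eq_square)
  moreover have "J3 (Q y) \<bullet> e i = q i / (1 + h / 2 * lam i)"
    using fun_cong[OF J3_eq, of "e i"] resolvent_component[OF h2, of "Q (e i)" i]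
    by (simp add: y_def Q_eigen)
  ultimately show ?thesis by simp
qed

text \<open>The trace of \<open>J3 Q J3\<^sup>T\<close>, computed along rows instead of columns.\<close>

lemma summable_postprocessor_noise:
  assumes J3: "bounded_linear J3"
    and J3_eq: "J3 \<circ> Q \<circ> adjoint J3 = resolvent_op D A (h / 2) \<circ> Q"
  shows "summable (\<lambda>p. q p * (norm (J3 (e p)))\<^sup>2)"
proof -
  have h2: "0 < h / 2"
    using h_pos by simp
  let ?f = "\<lambda>p i. ennreal (q p * (J3 (e p) \<bullet> e i)\<^sup>2)"
  have row: "(\<Sum>i. ?f p i) = ennreal (q p * (norm (J3 (e p)))\<^sup>2)" for p
    using sums_mult[OF parseval_norm_sums[of "J3 (e p)"], of "q p"] q_nonneg
    by (subst suminf_ennreal2) (auto simp: sums_iff)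
  have column: "(\<Sum>p. ?f p i) = ennreal (q i / (1 + h / 2 * lam i))" for i
    using covariance_sums[OF assms, of i] q_nonneg
    by (subst suminf_ennreal2) (auto simp: sums_iff)
  have "(\<Sum>p. ennreal (q p * (norm (J3 (e p)))\<^sup>2)) = (\<integral>\<^sup>+p. (\<Sum>i. ?f p i) \<partial>count_space UNIV)"
    by (simp add: nn_integral_count_space_nat row)
  also have "\<dots> = (\<Sum>i. \<integral>\<^sup>+p. ?f p i \<partial>count_space UNIV)"
    by (rule nn_integral_suminf) simp
  also have "\<dots> = (\<Sum>i. ennreal (q i / (1 + h / 2 * lam i)))"
    by (simp add: nn_integral_count_space_nat column)
  also have "\<dots> < \<infinity>"
    using summable_div_affine_eigenvalues[OF h2] q_nonneg h2
    by (subst suminf_ennreal_finite_iff) (auto intro!: divide_nonneg_nonneg add_nonneg_nonneg simp: less_imp_le)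
  finally show ?thesis
    using q_nonneg by (subst (asm) suminf_ennreal_finite_iff) auto
qed

text \<open>
  The state has coefficients of order \<open>q p / (lam p)\<^sup>2\<close>, one power of \<open>lam\<close> smaller than those of
  the added noise, so \<open>reg_eqI\<close> applies with \<open>t = 1\<close> and \<open>\<delta> = 1\<close>.
\<close>

lemma postprocessor_reg:
  assumes J3: "bounded_linear J3"
    and J3_eq: "J3 \<circ> Q \<circ> adjoint J3 = resolvent_op D A (h / 2) \<circ> Q"
    and U: "smooth_moments N U" and Z [measurable]: "Z \<in> measurable N M" and copy: "distr N M Z = M"
  shows "reg e lam (distr N borel (\<lambda>z. postprocessor e J3 h (U z) (\<xi> k (Z z)))) = s_bar e lam Q"
proof -
  define W where "W = (\<lambda>z. postprocessor e J3 h (U z) (\<xi> k (Z z)))"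
  define Y where "Y = (\<lambda>z. apply_op e J3 (\<xi> k (Z z)))"
  define c where "c = 1 / 2 * sqrt h"
  have h2: "0 < h / 2"
    using h_pos by simp
  have c_sq: "c\<^sup>2 = h / 4"
    using h_pos by (simp add: c_def power_mult_distrib power_divide)
  have W_eq: "W z = U z + c *\<^sub>R Y z" for z
    by (simp add: W_def Y_def postprocessor_def c_def)
  have scaled: "ennreal ((c * y)\<^sup>2) = ennreal (h / 4) * ennreal (y\<^sup>2)" for y
    unfolding power_mult_distrib c_sq by (rule ennreal_mult) (use h_pos in auto)
  have U_meas [measurable]: "U \<in> borel_measurable N"
    using U by (simp add: smooth_moments_def)
  obtain C where C: "0 \<le> C"
    "\<And>p. (\<integral>\<^sup>+z. ennreal ((U z \<bullet> e p)\<^sup>2) \<partial>N) \<le> ennreal (C * (q p * lam p powr (-2)))"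
    using U by (auto simp: smooth_moments_def)
  have Y_meas [measurable]: "Y \<in> borel_measurable N"
    unfolding Y_def using measurable_compose[OF Z apply_op_measurable] .
  have W_meas [measurable]: "W \<in> borel_measurable N"
    unfolding W_eq[abs_def] by measurable
  let ?mU = "\<lambda>p. \<integral>\<^sup>+z. ennreal ((U z \<bullet> e p)\<^sup>2) \<partial>N"
  let ?mY = "\<lambda>p. \<integral>\<^sup>+z. ennreal ((Y z \<bullet> e p)\<^sup>2) \<partial>N"
  let ?mW = "\<lambda>p. \<integral>\<^sup>+z. ennreal ((W z \<bullet> e p)\<^sup>2) \<partial>N"
  let ?v = "\<lambda>p. q p / (1 + h / 2 * lam p)"
  let ?w = "\<lambda>p. q p * lam p powr (-1)"
  let ?w2 = "\<lambda>p. q p * lam p powr (-1 - 1)"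
  have nonneg: "0 \<le> ?w p" "0 \<le> ?w2 p" for p
    using q_nonneg by auto
  have mU: "?mU p \<le> ennreal (C * ?w2 p)" for p
    using C(2)[of p] by simp
  have "?mY p = (\<integral>\<^sup>+\<omega>. ennreal ((apply_op e J3 (\<xi> k \<omega>) \<bullet> e p)\<^sup>2) \<partial>M)" for p
    unfolding Y_def by (subst copy[symmetric], subst nn_integral_distr) auto
  then have mY: "?mY p \<le> ennreal (?v p)" "ennreal (?v p) \<le> 2 * ?mY p" for p
    using second_moment_operator_noise[OF summable_postprocessor_noise[OF J3 J3_eq]
        covariance_sums[OF J3 J3_eq, of p], of k] by auto
  have powr_m1: "lam p powr (-1) = 1 / lam p" for p
    by (simp add: powr_minus_divide less_imp_le)
  have v_upper: "?v p \<le> 2 / h * ?w p" for p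
    using mult_left_mono[OF resolvent_factor_upper[OF h2, of p] q_nonneg[of p]]
    by (simp add: powr_m1 mult_ac abs_of_pos)
  define K where "K = 1 / lam 0 + h / 2"
  have K: "0 < K"
    using h_pos by (simp add: K_def add_pos_pos)
  have v_lower: "?w p \<le> K * ?v p" for p
    using mult_left_mono[OF mult_left_mono[OF resolvent_factor_lower[OF h2, of p] q_nonneg[of p]], of K] K
    by (simp add: powr_m1 K_def abs_of_pos)
  have w2_le: "?w2 p \<le> 1 / lam 0 * ?w p" for p
  proof -
    have "lam p powr (-1 - 1) = 1 / lam p * lam p powr (-1)"
      using powr_add[of "lam p" "-1" "-1"] by (simp add: powr_m1 abs_of_pos)
    moreover have "1 / lam p \<le> 1 / lam 0"
      using eigenvalue_ge_first[of p] eigenvalue_0_pos by (intro divide_left_mono) auto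
    ultimately have "lam p powr (-1 - 1) \<le> 1 / lam 0 * lam p powr (-1)"
      by (simp only: mult_right_mono powr_ge_zero)
    from mult_left_mono[OF this q_nonneg[of p]] show ?thesis
      by (simp add: mult_ac)
  qed
  have upper: "?mW p \<le> ennreal ((2 * (C / lam 0) + 1) * ?w p)" for p
  proof -
    have "?mW p \<le> (\<integral>\<^sup>+z. 2 * ennreal ((U z \<bullet> e p)\<^sup>2) + 2 * (ennreal (h / 4) * ennreal ((Y z \<bullet> e p)\<^sup>2)) \<partial>N)"
      unfolding W_eq inner_add_left inner_scaleR_left scaled[symmetric]
      by (intro nn_integral_mono ennreal_square_add_le)
    also have "\<dots> = 2 * ?mU p + 2 * (ennreal (h / 4) * ?mY p)"
      by (simp add: nn_integral_add nn_integral_cmult)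
    also have "\<dots> \<le> 2 * ennreal (C * ?w2 p) + 2 * (ennreal (h / 4) * ennreal (?v p))"
      by (intro add_mono mult_left_mono mU mY) auto
    also have "\<dots> = ennreal (2 * (C * ?w2 p) + 2 * (h / 4 * ?v p))"
    proof -
      have lin: "2 * ennreal x + 2 * (ennreal y * ennreal z) = ennreal (2 * x + 2 * (y * z))"
        if "0 \<le> x" "0 \<le> y" "0 \<le> z" for x y z
        using that by (simp add: ennreal_plus ennreal_mult)
      have "0 \<le> ?v p"
        using q_nonneg[of p] h_pos by (intro divide_nonneg_nonneg add_nonneg_nonneg) (auto simp: less_imp_le)
      moreover have "0 \<le> C * ?w2 p"
        using C(1) nonneg(2) by (rule mult_nonneg_nonneg)
      ultimately show ?thesis
        using h_pos by (intro lin) auto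
    qed
    also have "\<dots> \<le> ennreal ((2 * (C / lam 0) + 1) * ?w p)"
    proof (rule ennreal_leI)
      have "2 * (C * ?w2 p) + 2 * (h / 4 * ?v p)
          \<le> 2 * (C * (1 / lam 0 * ?w p)) + 2 * (h / 4 * (2 / h * ?w p))"
        by (intro add_mono mult_left_mono w2_le v_upper C(1)) (use h_pos in auto)
      also have "\<dots> = (2 * (C / lam 0) + 1) * ?w p"
        using h_pos by (simp add: distrib_right add_divide_distrib)
      finally show "2 * (C * ?w2 p) + 2 * (h / 4 * ?v p) \<le> (2 * (C / lam 0) + 1) * ?w p" .
    qed
    finally show ?thesis .
  qed
  define K' where "K' = 16 * K / h * (1 + C)"
  have lower: "ennreal (?w p) \<le> ennreal K' * (?mW p + ennreal (?w2 p))" for p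
  proof -
    have "ennreal (h / 4) * ?mY p = (\<integral>\<^sup>+z. ennreal ((W z \<bullet> e p + - (U z \<bullet> e p))\<^sup>2) \<partial>N)"
      using h_pos by (subst nn_integral_cmult[symmetric])
        (auto intro!: nn_integral_cong simp: W_eq inner_add_left scaled[symmetric])
    also have "\<dots> \<le> (\<integral>\<^sup>+z. 2 * ennreal ((W z \<bullet> e p)\<^sup>2) + 2 * ennreal ((U z \<bullet> e p)\<^sup>2) \<partial>N)"
      by (rule nn_integral_mono) (metis ennreal_square_add_le power2_minus)
    also have "\<dots> = 2 * ?mW p + 2 * ?mU p"
      by (simp add: nn_integral_add nn_integral_cmult)
    also have "\<dots> \<le> 2 * ?mW p + 2 * (ennreal C * ennreal (?w2 p))"
      using mU[of p] C(1) nonneg[of p]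
      by (intro add_left_mono mult_left_mono) (auto simp: ennreal_mult[symmetric])
    also have "\<dots> \<le> 2 * (ennreal (1 + C) * ?mW p) + 2 * (ennreal (1 + C) * ennreal (?w2 p))"
    proof (intro add_mono mult_left_mono)
      have "1 * ?mW p \<le> ennreal (1 + C) * ?mW p"
        using C(1) by (intro mult_right_mono) auto
      then show "?mW p \<le> ennreal (1 + C) * ?mW p" by simp
      show "ennreal C * ennreal (?w2 p) \<le> ennreal (1 + C) * ennreal (?w2 p)"
        by (intro mult_right_mono ennreal_leI) auto
    qed auto
    also have "\<dots> = 2 * (ennreal (1 + C) * (?mW p + ennreal (?w2 p)))"
      by (simp only: distrib_left)
    finally have mY_le: "ennreal (h / 4) * ?mY p \<le> 2 * (ennreal (1 + C) * (?mW p + ennreal (?w2 p)))" .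
    have "?mY p = ennreal (4 / h) * (ennreal (h / 4) * ?mY p)"
      using h_pos by (simp add: mult.assoc[symmetric] ennreal_mult[symmetric])
    also have "\<dots> \<le> ennreal (4 / h) * (2 * (ennreal (1 + C) * (?mW p + ennreal (?w2 p))))"
      by (intro mult_left_mono mY_le) simp
    finally have "2 * ?mY p \<le> 2 * (ennreal (4 / h) * (2 * (ennreal (1 + C) * (?mW p + ennreal (?w2 p)))))"
      by (intro mult_left_mono) auto
    then have "ennreal (?v p) \<le> 2 * (ennreal (4 / h) * (2 * (ennreal (1 + C) * (?mW p + ennreal (?w2 p)))))"
      using mY(2)[of p] order_trans by blast
    then have "ennreal K * ennreal (?v p)
        \<le> ennreal K * (2 * (ennreal (4 / h) * (2 * (ennreal (1 + C) * (?mW p + ennreal (?w2 p))))))"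
      by (intro mult_left_mono) auto
    also have "\<dots> = (ennreal K * (2 * (ennreal (4 / h) * (2 * ennreal (1 + C)))))
        * (?mW p + ennreal (?w2 p))"
      by (simp only: mult.assoc)
    also have "ennreal K * (2 * (ennreal (4 / h) * (2 * ennreal (1 + C)))) = ennreal K'"
    proof -
      have "ennreal K' = ennreal (K * (2 * (4 / h * (2 * (1 + C)))))"
        by (simp add: K'_def algebra_simps add_divide_distrib)
      also have "\<dots> = ennreal K * ennreal (2 * (4 / h * (2 * (1 + C))))"
        using K h_pos C(1) by (intro ennreal_mult) auto
      also have "ennreal (2 * (4 / h * (2 * (1 + C)))) = 2 * ennreal (4 / h * (2 * (1 + C)))"
        using h_pos C(1) by (subst ennreal_mult) auto
      also have "ennreal (4 / h * (2 * (1 + C))) = ennreal (4 / h) * ennreal (2 * (1 + C))"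
        using h_pos C(1) by (intro ennreal_mult) auto
      also have "ennreal (2 * (1 + C)) = 2 * ennreal (1 + C)"
        using C(1) by (subst ennreal_mult) auto
      finally show ?thesis ..
    qed
    also have "ennreal K * ennreal (?v p) = ennreal (K * ?v p)"
      using K h_pos q_nonneg[of p] eigenvalue_pos[of p] by (intro ennreal_mult[symmetric]) (auto intro!: divide_nonneg_nonneg simp: less_imp_le)
    finally show ?thesis
      using order_trans[OF ennreal_leI[OF v_lower[of p]]] by blast
  qed
  have m_eq: "(\<integral>\<^sup>+u. ennreal ((u \<bullet> e p)\<^sup>2) \<partial>distr N borel W) = ?mW p" for p
    by (subst nn_integral_distr) auto
  define C' where "C' = (2 * (C / lam 0) + 1) + K'"
  have K'_nonneg: "0 \<le> K'" "0 \<le> 2 * (C / lam 0) + 1"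
    using K h_pos C(1) eigenvalue_0_pos
    by (auto simp: K'_def intro!: add_nonneg_nonneg divide_nonneg_nonneg simp: less_imp_le)
  have "reg e lam (distr N borel W) = s_bar e lam Q + ereal (1 - 1)"
  proof (rule reg_eqI[where \<delta>=1 and C=C'])
    show "0 \<le> C'"
      using K'_nonneg by (simp add: C'_def)
    show "(\<integral>\<^sup>+u. ennreal ((u \<bullet> e p)\<^sup>2) \<partial>distr N borel W) \<le> ennreal (C' * (q p * lam p powr (- 1)))" for p
      unfolding m_eq using K'_nonneg nonneg[of p]
      by (intro order_trans[OF upper] ennreal_leI mult_right_mono) (auto simp: C'_def)
    show "ennreal (q p * lam p powr (- 1)) \<le> ennreal C' *
        ((\<integral>\<^sup>+u. ennreal ((u \<bullet> e p)\<^sup>2) \<partial>distr N borel W) + ennreal (q p * lam p powr (- 1 - 1)))" for p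
      unfolding m_eq using K'_nonneg
      by (intro order_trans[OF lower] mult_right_mono ennreal_leI) (auto simp: C'_def)
  qed auto
  then show ?thesis
    by (simp add: W_def zero_ereal_def[symmetric])
qed

end

text \<open>
  The first marginal of an invariant distribution of the pair chain is invariant for the scheme
  itself, and the second one is the postprocessed law of the first.
\<close>

lemma (in damped_step) postprocessed_invariant_reg:
  fixes \<pi> :: "('a \<times> 'a) measure"
  assumes J3: "bounded_linear J3"
    and J3_eq: "J3 \<circ> Q \<circ> adjoint J3 = resolvent_op D A (h / 2) \<circ> Q"
    and inv: "invariant_distribution (\<lambda>z. distr M borel
      (\<lambda>\<omega>. (step (fst z) (\<xi> 0 \<omega>), postprocessor e J3 h (fst z) (\<xi> 0 \<omega>)))) \<pi>"
  shows "reg e lam (distr \<pi> borel fst) = s_bar e lam Q + 1"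
    and "reg e lam (distr \<pi> borel snd) = s_bar e lam Q"
proof -
  interpret \<pi>: prob_space \<pi>
    using inv by (simp add: invariant_distribution_def)
  have sets_\<pi>: "sets \<pi> = sets (borel \<Otimes>\<^sub>M borel)"
    unfolding borel_prod using inv by (simp add: invariant_distribution_def)
  have fst_meas [measurable]: "fst \<in> borel_measurable \<pi>" and snd_meas [measurable]: "snd \<in> borel_measurable \<pi>"
    by (simp_all add: measurable_cong_sets[OF sets_\<pi> refl])
  let ?N = "\<pi> \<Otimes>\<^sub>M M"
  define F :: "('a \<times> 'a) \<times> 'w \<Rightarrow> 'a" where "F = (\<lambda>z. step (fst (fst z)) (\<xi> 0 (snd z)))"
  define P :: "('a \<times> 'a) \<times> 'w \<Rightarrow> 'a" where "P = (\<lambda>z. postprocessor e J3 h (fst (fst z)) (\<xi> 0 (snd z)))"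
  have F_meas [measurable]: "F \<in> borel_measurable ?N"
    unfolding F_def by measurable
  have "(\<lambda>\<omega>. apply_op e J3 (\<xi> 0 \<omega>)) \<in> borel_measurable M"
    by measurable
  from measurable_compose[OF measurable_snd this]
  have [measurable]: "(\<lambda>z. apply_op e J3 (\<xi> 0 (snd z))) \<in> borel_measurable ?N" .
  have P_meas [measurable]: "P \<in> borel_measurable ?N"
    unfolding P_def postprocessor_def by measurable
  have pair_meas: "(\<lambda>z. (F z, P z)) \<in> measurable ?N borel"
    unfolding borel_prod[symmetric] by measurable
  have "\<pi> = \<pi> \<bind> (\<lambda>z. distr M borel
      (\<lambda>\<omega>. (step (fst z) (\<xi> 0 \<omega>), postprocessor e J3 h (fst z) (\<xi> 0 \<omega>))))"
    using inv by (simp add: invariant_distribution_def)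
  also have "\<dots> = distr ?N borel (case_prod
      (\<lambda>z \<omega>. (step (fst z) (\<xi> 0 \<omega>), postprocessor e J3 h (fst z) (\<xi> 0 \<omega>))))"
    using pair_meas by (intro bind_distr_eq_distr_pair \<pi>.prob_space_axioms)
      (simp add: F_def P_def case_prod_beta')
  finally have \<pi>_eq: "\<pi> = distr ?N borel (\<lambda>z. (F z, P z))"
    by (simp add: F_def P_def case_prod_beta')
  have "distr \<pi> borel fst = distr (distr ?N borel (\<lambda>z. (F z, P z))) borel fst"
    using \<pi>_eq by simp
  also have "\<dots> = distr ?N borel F"
    by (subst distr_distr[OF _ pair_meas]) (auto simp: comp_def borel_prod[symmetric])
  finally have fst_eq: "distr \<pi> borel fst = distr ?N borel F" .
  have "distr \<pi> borel snd = distr (distr ?N borel (\<lambda>z. (F z, P z))) borel snd"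
    using \<pi>_eq by simp
  also have "\<dots> = distr ?N borel P"
    by (subst distr_distr[OF _ pair_meas]) (auto simp: comp_def borel_prod[symmetric])
  finally have snd_eq: "distr \<pi> borel snd = distr ?N borel P" .
  let ?\<nu> = "distr \<pi> borel fst"
  have kernel: "(\<lambda>v. distr M borel (\<lambda>\<omega>. step v (\<xi> 0 \<omega>))) \<in> measurable borel (subprob_algebra borel)"
    using step_measurable[of 0] by (intro distr_kernel_measurable) (simp add: case_prod_beta')
  have "?\<nu> \<bind> (\<lambda>v. distr M borel (\<lambda>\<omega>. step v (\<xi> 0 \<omega>)))
      = \<pi> \<bind> (\<lambda>z. distr M borel (\<lambda>\<omega>. step (fst z) (\<xi> 0 \<omega>)))"
    by (rule bind_distr[OF fst_meas kernel \<pi>.not_empty])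
  also have "\<dots> = distr ?N borel (case_prod (\<lambda>z \<omega>. step (fst z) (\<xi> 0 \<omega>)))"
    using F_meas by (intro bind_distr_eq_distr_pair \<pi>.prob_space_axioms)
      (simp add: F_def case_prod_beta')
  also have "\<dots> = ?\<nu>"
    by (simp add: fst_eq F_def case_prod_beta')
  finally have "invariant_distribution (\<lambda>v. distr M borel (\<lambda>\<omega>. step v (\<xi> 0 \<omega>))) ?\<nu>"
    by (simp add: invariant_distribution_def \<pi>.prob_space_distr)
  note marginal = invariant_smooth_and_reg[OF this]
  show "reg e lam ?\<nu> = s_bar e lam Q + 1"
    by (rule marginal)
  have copy: "distr ?N M snd = M"
    by (rule distr_pair_snd_prob[OF \<pi>.prob_space_axioms])
  have "distr ?N borel (\<lambda>z. fst (fst z)) = distr (distr ?N \<pi> fst) borel fst"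
    by (subst distr_distr) (auto simp: comp_def)
  also have "\<dots> = distr ?\<nu> borel (\<lambda>v. v)"
    using distr_id2[of borel ?\<nu>] by (simp add: distr_pair_fst id_def)
  finally have "smooth_moments ?N (\<lambda>z. fst (fst z))"
    using marginal(1) smooth_moments_cong_distr[of "\<lambda>z. fst (fst z)" ?N "\<lambda>v. v" ?\<nu>] by simp
  from postprocessor_reg[OF J3 J3_eq this measurable_snd copy, of 0]
  show "reg e lam (distr \<pi> borel snd) = s_bar e lam Q"
    by (simp add: snd_eq P_def)
qed

section \<open>Spatial regularity of the schemes\<close>

theorem proposition3p9:
  fixes D :: "'a::{real_inner, banach, second_countable_topology} set"
    and A Q J1 J2 J3 :: "'a \<Rightarrow> 'a"
    and e :: "nat \<Rightarrow> 'a"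
    and lam q :: "nat \<Rightarrow> real"
    and M :: "'w measure"
    and \<beta> :: "nat \<Rightarrow> real \<Rightarrow> 'w \<Rightarrow> real"
    and h :: real
    and \<xi> :: "nat \<Rightarrow> 'w \<Rightarrow> nat \<Rightarrow> real"
    and v u ubar :: "nat \<Rightarrow> 'w \<Rightarrow> 'a"
    and n :: nat
  assumes A_self_adjoint: "self_adjoint_operator D (\<lambda>x. - A x)"
    and e_basis: "complete_orthonormal_system e"
    and A_eigen: "\<And>p. e p \<in> D \<and> A (e p) = - (lam p *\<^sub>R e p)"
    and lam_pos: "0 < lam 0"
    and lam_mono: "incseq lam"
    and lam_unbounded: "filterlim lam at_top sequentially"
    and Q_bounded: "bounded_linear Q"
    and Q_self_adjoint: "\<And>x y. Q x \<bullet> y = x \<bullet> Q y"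
    and Q_nonneg: "\<And>x. 0 \<le> Q x \<bullet> x"
    and Q_eigen: "\<And>p. Q (e p) = q p *\<^sub>R e p"
    and q_nonneg: "\<And>p. 0 \<le> q p"
    and q_bounded: "bounded (range q)"
    and trace_condition: "0 < s_bar e lam Q"
    and not_truncated: "\<And>s::real. 1 < s \<Longrightarrow> trace_op e (frac_power e lam (-1 + s) \<circ> Q) = \<infinity>"
    and prob: "prob_space M"
    and wiener: "independent_wiener_processes M \<beta>"
    and h_pos: "0 < h"
    and \<xi>_def: "\<xi> = xiQ q \<beta> h"
    and J1_def: "J1 = resolvent_op D A h"
    and J2_def: "J2 = resolvent_op D A ((3 - sqrt 2) / 2 * h)"
    and J3_bounded: "bounded_linear J3"
    and J3_eq: "J3 \<circ> Q \<circ> adjoint J3 = resolvent_op D A (h / 2) \<circ> Q"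
    and v_0: "\<And>\<omega>. v 0 \<omega> = 0"
    and v_Suc: "\<And>k \<omega>. v (Suc k) \<omega> = euler_step e J1 h (v k \<omega>) (\<xi> k \<omega>)"
    and u_0: "\<And>\<omega>. u 0 \<omega> = 0"
    and u_Suc: "\<And>k \<omega>. u (Suc k) \<omega> = integrator_step e J1 J2 h (u k \<omega>) (\<xi> k \<omega>)"
    and ubar: "\<And>k \<omega>. ubar k \<omega> = postprocessor e J3 h (u k \<omega>) (\<xi> k \<omega>)"
    and n_pos: "1 \<le> n"
  shows "reg e lam (distr M borel (v n)) = s_bar e lam Q + 1
       \<and> reg e lam (distr M borel (u n)) = s_bar e lam Q + 1
       \<and> (\<forall>\<nu>. invariant_distribution (euler_kernel M e J1 h \<xi>) \<nu> \<longrightarrow>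
             reg e lam \<nu> = s_bar e lam Q + 1)
       \<and> reg e lam (distr M borel (ubar n)) = s_bar e lam Q
       \<and> (\<forall>\<pi>. invariant_distribution (postprocessed_kernel M e J1 J2 J3 h \<xi>) \<pi> \<longrightarrow>
             reg e lam (distr \<pi> borel fst) = s_bar e lam Q + 1 \<and>
             reg e lam (distr \<pi> borel snd) = s_bar e lam Q)"
proof -
  have diagonal: "diagonal_operator e D A lam"
    by unfold_locales fact+
  have trace: "trace_class_noise e D A lam Q q"
    by (intro trace_class_noise.intro trace_class_noise_axioms.intro diagonal) fact+
  have noise: "\<exists>X. white_noise M X \<and> (\<forall>\<omega> p. \<xi> k \<omega> p = sqrt (q p) * X p \<omega>)" for k
  proof -
    let ?s = "real k * h" and ?t = "(real k + 1) * h"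
    have len: "?t - ?s = h"
      by (simp add: algebra_simps)
    have "white_noise M (\<lambda>p \<omega>. (?t - ?s) powr (- 1 / 2) * (\<beta> p ?t \<omega> - \<beta> p ?s \<omega>))"
      using h_pos by (intro white_noise_wiener_increments prob wiener) auto
    then have "white_noise M (\<lambda>p \<omega>. h powr (- 1 / 2) * (\<beta> p ?t \<omega> - \<beta> p ?s \<omega>))"
      unfolding len .
    moreover have "\<xi> k \<omega> p = sqrt (q p) * (h powr (- 1 / 2) * (\<beta> p ?t \<omega> - \<beta> p ?s \<omega>))" for \<omega> p
      by (simp add: \<xi>_def xiQ_def WQ_def right_diff_distrib mult_ac)
    ultimately show ?thesis by blast
  qed
  interpret noise_input e D A lam Q q M \<xi> h
    by (intro noise_input.intro noise_input_axioms.intro trace prob noise h_pos)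
  interpret euler: damped_step e D A lam Q q M \<xi> h "euler_step e J1 h"
      "\<lambda>p. sqrt h / (1 + h * lam p)" "sqrt h * (1 / (1 / lam 0 + h))" "sqrt h * (1 / h)"
    unfolding J1_def by (rule damped_step_euler)
  interpret integrator: damped_step e D A lam Q q M \<xi> h "integrator_step e J1 J2 h"
      "\<lambda>p. sqrt h * ((sqrt 2 - 1) / 2 / (1 + h * lam p) + (3 - sqrt 2) / 2)
        / (1 + (3 - sqrt 2) / 2 * h * lam p)"
      "sqrt h * ((3 - sqrt 2) / 2) * (1 / (1 / lam 0 + (3 - sqrt 2) / 2 * h))"
      "sqrt h * ((sqrt 2 - 1) / 2 + (3 - sqrt 2) / 2) * (1 / ((3 - sqrt 2) / 2 * h))"
    unfolding J1_def J2_def by (rule damped_step_integrator)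
  have ubar_eq: "ubar n = (\<lambda>\<omega>. postprocessor e J3 h (u n \<omega>) (\<xi> n \<omega>))"
    using ubar by auto
  have "reg e lam (distr M borel (ubar n)) = s_bar e lam Q"
    unfolding ubar_eq
    using postprocessor_reg[OF J3_bounded J3_eq integrator.chain_smooth[OF u_0 u_Suc], of "\<lambda>\<omega>. \<omega>"]
    by simp
  moreover have "reg e lam (distr M borel (v n)) = s_bar e lam Q + 1"
    by (rule euler.chain_reg[OF v_0 v_Suc n_pos])
  moreover have "reg e lam (distr M borel (u n)) = s_bar e lam Q + 1"
    by (rule integrator.chain_reg[OF u_0 u_Suc n_pos])
  moreover have "reg e lam \<nu> = s_bar e lam Q + 1"
    if "invariant_distribution (euler_kernel M e J1 h \<xi>) \<nu>" for \<nu>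
    using that unfolding euler_kernel_def[abs_def] by (rule euler.invariant_smooth_and_reg(2))
  moreover have "reg e lam (distr \<pi> borel fst) = s_bar e lam Q + 1 \<and>
      reg e lam (distr \<pi> borel snd) = s_bar e lam Q"
    if "invariant_distribution (postprocessed_kernel M e J1 J2 J3 h \<xi>) \<pi>" for \<pi>
    using that unfolding postprocessed_kernel_def[abs_def]
    by (intro conjI integrator.postprocessed_invariant_reg[OF J3_bounded J3_eq])
  ultimately show ?thesis
    by blast
qed

end
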